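(* Let $d\ge 2$. Let $f\in L^1(\mathbb{R}^d)$ be a nonzero, real-valued, radial function such that $f(0)\le 0$, $\widehat f\in L^1(\mathbb{R}^d)$ and $\widehat f(0)\le 0$. Then $$A(f)A(\widehat f)\ \ge\ \frac1\pi\Big(\frac{1}{1+\lambda_d}\,\Gamma\Big(\frac d2+1\Big)\Big)^{2/d},$$ where $$\lambda_d:=-\inf_{u>0}\frac{\Gamma\big(\frac d2+1\big)\,J_{d/2}(u)}{(u/2)^{d/2}} .$$ Moreover, $\lambda_d<\frac12$ for every $d\ge 2$, and $\lambda_d\to 0$ exponentially fast as $d\to\infty$ (i.e. there exist constants $C>0$ and $0<q<1$ such that $|\lambda_d|\le C q^d$ for all $d\ge 2$).
   Context: The Fourier transform on $\mathbb{R}^d$ is normalized by $\widehat f(y)=\int_{\mathbb{R}^d} f(x)e^{-2\pi i x\cdot y}\,dx$. Since $f$ is real-valued and radial, so is $\widehat f$. Since $f$ and $\widehat f$ are both integrable, $f$ is identified with its continuous representative. For a real-valued function $g$ on $\mathbb{R}^d$, $A(g):=\inf\{r>0:\ g(x)\ge 0\text{ for all }|x|>r\}\in[0,\infty]$ (with $A(g)=\infty$ if no such $r$ exists); under the hypotheses on $f$ both $A(f)$ and $A(\widehat f)$ are strictly positive, and the product is $\infty$ if either factor is. $J_\nu$ is the Bessel function of the first kind, $J_\nu(z)=\big(\tfrac z2\big)^\nu\sum_{n=0}^\infty\frac{(-1)^n (z/2)^{2n}}{n!\,\Gamma(\nu+n+1)}$, and $\Gamma$ is the Gamma function. *)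

theory Defs
  imports "HOL-Analysis.Analysis"
begin

definition fourier :: "(real ^ 'n \<Rightarrow> real) \<Rightarrow> real ^ 'n \<Rightarrow> complex" where
  "fourier f y =
     (\<integral>x. complex_of_real (f x) * exp (- 2 * complex_of_real pi * \<i> * complex_of_real (x \<bullet> y)) \<partial>lborel)"

definition radial :: "(real ^ 'n \<Rightarrow> real) \<Rightarrow> bool" where
  "radial f \<longleftrightarrow> (\<forall>x y. norm x = norm y \<longrightarrow> f x = f y)"

lemma distr_uminus_lborel:
  "distr lborel borel uminus = (lborel :: (real ^ 'n) measure)"
proof -
  have "lborel = density (distr lborel borel (\<lambda>x :: real ^ 'n. 0 + (- 1) *\<^sub>R x))
                   (\<lambda>_. ennreal (\<bar>- 1\<bar> ^ DIM(real ^ 'n)))"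
    by (rule lborel_affine) simp
  also have "\<dots> = distr lborel borel (\<lambda>x. - x)"
    by (simp only: add_0_left scaleR_minus1_left abs_minus_cancel abs_one power_one ennreal_1 density_1)
  finally show ?thesis by (rule sym)
qed

text \<open>The transform of a radial function is real-valued, so passing to \<open>Re (fourier f y)\<close> loses
  no information.\<close>

lemma Im_fourier_radial:
  fixes f :: "real ^ 'n \<Rightarrow> real"
  assumes "radial f" and [measurable]: "f \<in> borel_measurable borel"
  shows "Im (fourier f y) = 0"
proof -
  let ?g = "\<lambda>x. complex_of_real (f x) * exp (- 2 * complex_of_real pi * \<i> * complex_of_real (x \<bullet> y))"
  have even: "f (- x) = f x" for x
    using assms(1) norm_minus_cancel [of x] unfolding radial_def by blast
  have "cnj (fourier f y) = (\<integral>x. cnj (?g x) \<partial>lborel)"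
    unfolding fourier_def by (rule Bochner_Integration.integral_cnj [symmetric])
  also have "\<dots> = (\<integral>x. ?g (- x) \<partial>lborel)"
    by (simp only: even complex_cnj_mult exp_cnj complex_cnj_complex_of_real complex_cnj_i
        complex_cnj_minus complex_cnj_numeral inner_minus_left of_real_minus mult_minus_left mult_minus_right)
  also have "\<dots> = integral\<^sup>L (distr lborel borel uminus) ?g"
    by (rule integral_distr [symmetric]) measurable
  also have "distr lborel borel uminus = (lborel :: (real ^ 'n) measure)"
    by (rule distr_uminus_lborel)
  also have "integral\<^sup>L lborel ?g = fourier f y"
    by (simp add: fourier_def)
  finally show ?thesis
    by (simp add: complex_eq_iff)
qed

text \<open>The infimum is taken in the extended reals, so it is \<open>\<infinity>\<close> when no radius qualifies.\<close>

definition sign_radius :: "(real ^ 'n \<Rightarrow> real) \<Rightarrow> ereal" where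
  "sign_radius g = Inf {ereal r | r. r > 0 \<and> (\<forall>x. norm x > r \<longrightarrow> g x \<ge> 0)}"

definition bessel_J :: "real \<Rightarrow> real \<Rightarrow> real" where
  "bessel_J \<nu> z =
     (z / 2) powr \<nu> * (\<Sum>n. (- 1) ^ n * (z / 2) ^ (2 * n) / (fact n * Gamma (\<nu> + real n + 1)))"

text \<open>The set is bounded below (the quotient has absolute value at most 1), so the real infimum
  is the genuine one.\<close>

definition lam :: "nat \<Rightarrow> real" where
  "lam d = - (INF u\<in>{0<..}.
     Gamma (real d / 2 + 1) * bessel_J (real d / 2) u / (u / 2) powr (real d / 2))"

end

theory Submission
  imports Defs "HOL-Probability.Levy"
begin

text \<open>
  Since \<open>f\<close> is even, \<open>f\<close> and \<open>F = Re (fourier f)\<close> are cosine transforms of each other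
  (\<open>cos_transform_inversion\<close>), and the sign conditions at the origin say that both have integral at most \<open>0\<close>:
  the mass of the positive part does not exceed the mass of the negative part.

  Suppose \<open>F\<close> is nonnegative outside the ball \<open>B\<close> of radius \<open>r\<close>, and let \<open>S \<subseteq> B\<close> be the set where \<open>F < 0\<close>.
  The negative mass of \<open>F\<close> is minus the integral of \<open>f\<close> against the transform \<open>c\<close> of the indicator of \<open>S\<close>.  Here
  \<open>c \<le> vol S\<close>, and \<open>vol S - c\<close> is the integral over \<open>S\<close> of the nonnegative function \<open>1 - cos\<close>, hence at most the
  same integral over all of \<open>B\<close>.  The latter is explicit, because the transform of a ball is its volume times the
  normalised Bessel function (\<open>integral_ball_cos\<close>), which is at least \<open>- lam d\<close>; so \<open>vol S - c \<le> vol B * (1 + lam d)\<close>.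
  Since positive mass is at most negative mass, the negative mass of \<open>F\<close> is at most \<open>vol B * (1 + lam d)\<close> times
  that of \<open>f\<close> (\<open>negative_mass_bound\<close>).  Exchanging the roles of \<open>f\<close> and \<open>F\<close> and multiplying the two
  inequalities gives \<open>1 \<le> vol B\<^sub>1 * vol B\<^sub>2 * (1 + lam d)^2\<close>, which is the asserted lower bound for the product of
  the radii.

  The bounds for \<open>lam d\<close> come from the series of the normalised Bessel function in the variable \<open>s = (u / 2)^2\<close>.
  The energy, value squared plus derivative squared, decreases, so a nonnegative initial stretch followed by one
  small value of the energy bounds \<open>lam d\<close> (\<open>lam_le_sqrt_energy\<close>).  With \<open>a = d / 2 + 1\<close>, the point \<open>s = a\<close> gives
  \<open>lam d < 1 / 2\<close>, and the point \<open>s = a^2 / 4\<close>, up to which the function is still positive but already exponentially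
  small in \<open>d\<close>, gives exponential decay.
\<close>

section \<open>The normalised Bessel function\<close>

text \<open>This is the hypergeometric function \<open>0F1(; a; -s)\<close>.  With \<open>a = \<nu> + 1\<close> and \<open>s = (u / 2)^2\<close> it is
  the Bessel function \<open>J\<^sub>\<nu>(u)\<close> divided by its leading behaviour at \<open>0\<close>.  In the variable \<open>s\<close> it is entire, no
  real powers occur, and both differentiation and the recurrences merely shift \<open>a\<close> by integers.\<close>

definition bessel_phi :: "real \<Rightarrow> real \<Rightarrow> real" where
  "bessel_phi a s = (\<Sum>n. (-1) ^ n / (fact n * pochhammer a n) * s ^ n)"

lemma pochhammer_ge_1:
  fixes a :: real
  assumes "a \<ge> 1"
  shows "pochhammer a n \<ge> 1"
proof (induction n)
  case (Suc n)
  have "1 * 1 \<le> pochhammer a n * (a + real n)"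
    using Suc assms by (intro mult_mono) auto
  then show ?case by (simp add: pochhammer_Suc)
qed simp

lemma summable_bessel_phi:
  fixes a s :: real
  assumes "a \<ge> 1"
  shows "summable (\<lambda>n. (-1) ^ n / (fact n * pochhammer a n) * s ^ n)"
proof (rule summable_comparison_test'[where N = 0])
  show "summable (\<lambda>n. inverse (fact n) * \<bar>s\<bar> ^ n)"
    by (rule summable_exp)
  fix n :: nat
  have p: "pochhammer a n \<ge> 1" by (rule pochhammer_ge_1[OF assms])
  then have "\<bar>s\<bar> ^ n / (fact n * pochhammer a n) \<le> \<bar>s\<bar> ^ n / (fact n * 1)"
    by (intro divide_left_mono mult_left_mono) auto
  with p show "norm ((-1) ^ n / (fact n * pochhammer a n) * s ^ n) \<le> inverse (fact n) * \<bar>s\<bar> ^ n"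
    by (simp add: abs_mult power_abs field_simps)
qed

lemma bessel_phi_0 [simp]: "bessel_phi a 0 = 1"
  unfolding bessel_phi_def using powser_zero[of "\<lambda>n. (-1) ^ n / (fact n * pochhammer a n)"] by simp

lemma bessel_phi_deriv:
  assumes "a \<ge> 1"
  shows "(bessel_phi a has_real_derivative - bessel_phi (a + 1) s / a) (at s)"
proof -
  let ?c = "\<lambda>n. (-1) ^ n / (fact n * pochhammer a n) :: real"
  have "DERIV (\<lambda>x. \<Sum>n. ?c n * x ^ n) s :> (\<Sum>n. diffs ?c n * s ^ n)"
    by (rule termdiffs_strong_converges_everywhere) (rule summable_bessel_phi[OF assms])
  moreover have "diffs ?c n * s ^ n =
      (- 1 / a) * ((-1) ^ n / (fact n * pochhammer (a + 1) n) * s ^ n)" for n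
  proof -
    have "pochhammer (a + 1) n \<noteq> 0" using pochhammer_ge_1[of "a + 1" n] assms by simp
    moreover have "1 + real n \<noteq> 0" "a \<noteq> 0" using assms by auto
    ultimately show ?thesis
      by (simp add: diffs_def pochhammer_rec divide_simps)
  qed
  moreover have "(\<Sum>n. (- 1 / a) * ((-1) ^ n / (fact n * pochhammer (a + 1) n) * s ^ n)) =
      (- 1 / a) * bessel_phi (a + 1) s"
    unfolding bessel_phi_def using assms by (intro suminf_mult summable_bessel_phi) simp
  ultimately show ?thesis by (simp add: bessel_phi_def[abs_def])
qed

text \<open>The classical recurrence \<open>J\<^sub>\<nu>\<^sub>-\<^sub>1 + J\<^sub>\<nu>\<^sub>+\<^sub>1 = (2 \<nu> / u) J\<^sub>\<nu>\<close> with \<open>a = \<nu>\<close>, obtained by comparing coefficients.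
  Together with the derivative formula it replaces the Bessel differential equation in all that follows.\<close>

lemma bessel_phi_contiguous:
  assumes "a \<ge> 1"
  shows "bessel_phi a s = bessel_phi (a + 1) s - s / (a * (a + 1)) * bessel_phi (a + 2) s"
proof -
  let ?t = "\<lambda>a n. (-1) ^ n / (fact n * pochhammer a n) * s ^ n :: real"
  have S: "summable (?t a)" "summable (?t (a + 1))" "summable (?t (a + 2))"
    using assms by (intro summable_bessel_phi; simp)+
  have term_eq: "?t a (Suc n) - ?t (a + 1) (Suc n) = - (s / (a * (a + 1))) * ?t (a + 2) n" for n
  proof -
    define P where "P = pochhammer (a + 2) n"
    define Q where "Q = pochhammer (a + 1) n"
    have P: "P > 0" and Q: "Q > 0"
      using pochhammer_ge_1[of "a + 2" n] pochhammer_ge_1[of "a + 1" n] assms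
      by (auto simp: P_def Q_def)
    have PQ: "(a + 1) * P = Q * (a + 1 + real n)"
      using pochhammer_rec[of "a + 1" n] pochhammer_Suc[of "a + 1" n]
      by (simp add: P_def Q_def algebra_simps)
    have "1 / (a * Q) - 1 / ((a + 1) * P) = (1 + real n) / (a * ((a + 1) * P))"
    proof -
      have "a \<noteq> 0" "Q \<noteq> 0" "a + 1 + real n \<noteq> 0" using assms Q by auto
      then show ?thesis unfolding PQ by (simp add: divide_simps)
    qed
    moreover have "1 + real n \<noteq> 0" by simp
    ultimately have *: "(1 / (a * Q) - 1 / ((a + 1) * P)) / (1 + real n) = 1 / (a * (a + 1) * P)"
      by simp
    have "?t a (Suc n) = - (((-1) ^ n * s ^ n / fact n) * s * (1 / (a * Q) / (1 + real n)))"
      by (simp add: pochhammer_rec Q_def[symmetric] mult_ac)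
    moreover have "?t (a + 1) (Suc n) =
        - (((-1) ^ n * s ^ n / fact n) * s * (1 / ((a + 1) * P) / (1 + real n)))"
      by (simp add: pochhammer_rec P_def[symmetric] add.assoc mult_ac)
    ultimately have "?t a (Suc n) - ?t (a + 1) (Suc n) =
        - (((-1) ^ n * s ^ n / fact n) * s * ((1 / (a * Q) - 1 / ((a + 1) * P)) / (1 + real n)))"
      by (simp only: diff_divide_distrib right_diff_distrib)
    also have "\<dots> = - (s / (a * (a + 1))) * ?t (a + 2) n"
      by (subst *) (simp add: P_def mult_ac)
    finally show ?thesis .
  qed
  have "bessel_phi a s - bessel_phi (a + 1) s = (\<Sum>n. ?t a n - ?t (a + 1) n)"
    unfolding bessel_phi_def by (rule suminf_diff[OF S(1,2)])
  also have "\<dots> = (\<Sum>n. ?t a (Suc n) - ?t (a + 1) (Suc n))"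
    using suminf_split_head[OF summable_diff[OF S(1,2)]] by simp
  also have "\<dots> = - (s / (a * (a + 1))) * bessel_phi (a + 2) s"
    unfolding term_eq bessel_phi_def by (rule suminf_mult[OF S(3)])
  finally show ?thesis by simp
qed

text \<open>For \<open>s \<le> a\<close> the terms of the alternating series decrease weakly from the start, so that consecutive partial
  sums enclose the value.\<close>

lemma bessel_phi_bounds:
  assumes "a \<ge> 1" "0 \<le> s" "s \<le> a"
  shows "1 - s / a \<le> bessel_phi a s"
    and "bessel_phi a s \<le> 1 - s / a + s\<^sup>2 / (2 * a * (a + 1))"
    and "bessel_phi a s \<le> 1"
proof -
  define b where "b = (\<lambda>n. s ^ n / (fact n * pochhammer a n))"
  have p: "pochhammer a n > 0" for n using pochhammer_ge_1[OF assms(1), of n] by linarith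
  have eq: "(-1) ^ n * b n = (-1) ^ n / (fact n * pochhammer a n) * s ^ n" for n
    by (simp add: b_def)
  have "summable (\<lambda>n. (-1) ^ n * b n)"
    unfolding eq by (rule summable_bessel_phi[OF assms(1)])
  then have "(\<lambda>n. \<bar>(-1) ^ n * b n\<bar>) \<longlonglongrightarrow> 0"
    by (intro tendsto_rabs_zero summable_LIMSEQ_zero)
  then have lim: "b \<longlonglongrightarrow> 0"
    by (subst tendsto_rabs_zero_iff[symmetric]) (simp add: abs_mult)
  have nonneg: "0 \<le> b n" for n using p[of n] assms by (simp add: b_def)
  have mono: "b (Suc n) \<le> b n" for n
  proof -
    have "s * 1 \<le> (a + real n) * (1 + real n)" using assms by (intro mult_mono) auto
    then have "s / ((a + real n) * (1 + real n)) \<le> 1" using assms by (simp add: divide_le_eq)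
    then have "b n * (s / ((a + real n) * (1 + real n))) \<le> b n"
      using nonneg[of n] mult_left_le by blast
    also have "b n * (s / ((a + real n) * (1 + real n))) = b (Suc n)"
      using p[of n] by (simp add: b_def pochhammer_Suc mult_ac)
    finally show ?thesis .
  qed
  note leib = summable_Leibniz'[OF lim nonneg mono]
  have "(\<Sum>n. (-1) ^ n * b n) = bessel_phi a s" unfolding eq bessel_phi_def ..
  then show "1 - s / a \<le> bessel_phi a s" "bessel_phi a s \<le> 1 - s / a + s\<^sup>2 / (2 * a * (a + 1))"
    "bessel_phi a s \<le> 1"
    using leib(2)[of 1] leib(4)[of 1] leib(4)[of 0]
    by (simp_all add: b_def eval_nat_numeral pochhammer_Suc mult_ac)
qed

text \<open>Regarded as a function of \<open>u = 2 sqrt s\<close>, this is the value squared plus the \<open>u\<close>-derivative squared: the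
  mechanical energy of the oscillator described by the Bessel equation.\<close>

definition bessel_energy :: "real \<Rightarrow> real \<Rightarrow> real" where
  "bessel_energy a s = (bessel_phi a s)\<^sup>2 + s / a\<^sup>2 * (bessel_phi (a + 1) s)\<^sup>2"

text \<open>The first-order term of the Bessel equation is a friction term.  In the computation below the energy
  has derivative \<open>Q^2 (1 / a^2 - 2 / a)\<close>, where \<open>Q\<close> is the function with parameter \<open>a + 1\<close>; the recurrence is what
  eliminates the parameter \<open>a + 2\<close>.\<close>

lemma bessel_energy_antimono:
  assumes "a \<ge> 1" "s \<le> t"
  shows "bessel_energy a t \<le> bessel_energy a s"
proof (rule DERIV_nonpos_imp_nonincreasing[OF assms(2)])
  fix x :: real
  let ?P = "bessel_phi a x" and ?Q = "bessel_phi (a + 1) x" and ?R = "bessel_phi (a + 2) x"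
  have dP: "(bessel_phi a has_real_derivative - ?Q / a) (at x)"
    by (rule bessel_phi_deriv[OF assms(1)])
  have dQ: "(bessel_phi (a + 1) has_real_derivative - ?R / (a + 1)) (at x)"
    using bessel_phi_deriv[of "a + 1" x] assms by (simp add: add.assoc)
  have xR: "x * ?R / (a + 1) = a * (?Q - ?P)"
  proof -
    have nz: "a \<noteq> 0" "a + 1 \<noteq> 0" using assms by auto
    have "x * ?R / (a + 1) = a * (x / (a * (a + 1)) * ?R)" using nz by simp
    also have "x / (a * (a + 1)) * ?R = ?Q - ?P"
      using bessel_phi_contiguous[OF assms(1), of x] by linarith
    finally show ?thesis .
  qed
  have "(bessel_energy a has_real_derivative
      2 * ?P * (- ?Q / a) + (?Q\<^sup>2 / a\<^sup>2 + x / a\<^sup>2 * (2 * ?Q * (- ?R / (a + 1))))) (at x)"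
  proof -
    define c where "c = 1 / a\<^sup>2"
    have "((\<lambda>s. (bessel_phi a s)\<^sup>2 + c * (s * (bessel_phi (a + 1) s)\<^sup>2)) has_real_derivative
      2 * ?P * (- ?Q / a) + c * (?Q\<^sup>2 + x * (2 * ?Q * (- ?R / (a + 1))))) (at x)"
      by (auto intro!: derivative_eq_intros dP dQ simp: mult_ac right_diff_distrib)
    then show ?thesis
      by (simp add: c_def bessel_energy_def[abs_def] right_diff_distrib diff_divide_distrib)
  qed
  also have "2 * ?P * (- ?Q / a) + (?Q\<^sup>2 / a\<^sup>2 + x / a\<^sup>2 * (2 * ?Q * (- ?R / (a + 1)))) =
      - 2 * ?P * ?Q / a + ?Q\<^sup>2 / a\<^sup>2 - 2 * ?Q / a\<^sup>2 * (x * ?R / (a + 1))"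
    by simp
  also have "\<dots> = ?Q\<^sup>2 * (1 / a\<^sup>2 - 2 / a)"
    unfolding xR using assms by (simp add: field_simps power2_eq_square)
  finally have "(bessel_energy a has_real_derivative ?Q\<^sup>2 * (1 / a\<^sup>2 - 2 / a)) (at x)" .
  moreover have "1 / a\<^sup>2 - 2 / a \<le> 0" using assms by (simp add: field_simps power2_eq_square)
  ultimately show "\<exists>y. (bessel_energy a has_real_derivative y) (at x) \<and> y \<le> 0"
    by (meson mult_nonneg_nonpos zero_le_power2)
qed

text \<open>One evaluation of the energy controls all later oscillations.  This turns bounds for an infimum over a
  half-line into estimates at a single point.\<close>

lemma abs_bessel_phi_le_energy:
  assumes "a \<ge> 1" "0 \<le> s" "s \<le> t"
  shows "\<bar>bessel_phi a t\<bar> \<le> sqrt (bessel_energy a s)"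
proof (rule real_le_rsqrt)
  have "\<bar>bessel_phi a t\<bar>\<^sup>2 \<le> bessel_energy a t"
    using assms by (simp add: bessel_energy_def)
  also have "\<dots> \<le> bessel_energy a s" by (rule bessel_energy_antimono[OF assms(1,3)])
  finally show "\<bar>bessel_phi a t\<bar>\<^sup>2 \<le> bessel_energy a s" .
qed

lemma abs_bessel_phi_le_1:
  assumes "a \<ge> 1" "0 \<le> s"
  shows "\<bar>bessel_phi a s\<bar> \<le> 1"
  using abs_bessel_phi_le_energy[OF assms(1) order.refl assms(2)] by (simp add: bessel_energy_def)

text \<open>Positivity far beyond the range of the alternating series, by downward induction on \<open>a\<close>.  When \<open>a\<close> is
  large compared with \<open>s\<close>, both values lie between \<open>1 / 2\<close> and \<open>1\<close>.  In the step from \<open>a + 1\<close> to \<open>a\<close> the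
  recurrence subtracts from the value at \<open>a + 1\<close> at most a quarter of the value at \<open>a + 2\<close>; as the latter is
  at most twice the former, at least half of the value at \<open>a + 1\<close> remains.\<close>

lemma bessel_phi_pos_and_ratio:
  assumes "a \<ge> 1" "0 \<le> s" "s \<le> a * (a + 1) / 4"
  shows "0 < bessel_phi a s \<and> bessel_phi (a + 1) s \<le> 2 * bessel_phi a s"
proof -
  have "0 < bessel_phi (a + real k) s \<and> bessel_phi (a + real k + 1) s \<le> 2 * bessel_phi (a + real k) s"
    if "k \<le> N" and N: "2 * s \<le> a + real N" for k N
    using that(1)
  proof (induction k rule: inc_induct)
    case base
    have "1 - s / (a + N) \<le> bessel_phi (a + N) s"
      using assms N by (intro bessel_phi_bounds) auto
    moreover have "s / (a + N) \<le> 1 / 2" using assms N by (simp add: field_simps)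
    moreover have "bessel_phi (a + N + 1) s \<le> 1"
      using assms N by (intro bessel_phi_bounds) auto
    ultimately show ?case by linarith
  next
    case (step k)
    let ?b = "a + real k"
    have IH: "0 < bessel_phi (?b + 1) s" "bessel_phi (?b + 2) s \<le> 2 * bessel_phi (?b + 1) s"
      using step.IH by (simp_all add: ac_simps)
    have b: "?b \<ge> 1" using assms by simp
    have "a * (a + 1) \<le> ?b * (?b + 1)" using assms by (intro mult_mono) auto
    then have c: "0 \<le> s / (?b * (?b + 1))" "s / (?b * (?b + 1)) \<le> 1 / 4"
      using assms b by (auto simp: divide_le_eq)
    have "s / (?b * (?b + 1)) * bessel_phi (?b + 2) s \<le> s / (?b * (?b + 1)) * (2 * bessel_phi (?b + 1) s)"
      by (rule mult_left_mono[OF IH(2) c(1)])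
    also have "\<dots> \<le> 1 / 4 * (2 * bessel_phi (?b + 1) s)"
      using IH(1) by (intro mult_right_mono c(2)) auto
    finally have "bessel_phi ?b s \<ge> bessel_phi (?b + 1) s / 2"
      using bessel_phi_contiguous[OF b, of s] by simp
    then show ?case using IH(1) by linarith
  qed
  from this[of 0 "nat \<lceil>2 * s\<rceil>"] show ?thesis
    using assms by simp linarith
qed

text \<open>Where the value at \<open>a + 2\<close> is positive, the recurrence shows that the value at \<open>a\<close> is at most the value
  at \<open>a + 1\<close>; the derivative formula then bounds the logarithmic derivative by \<open>- 1 / a\<close>.\<close>

lemma bessel_phi_le_exp:
  assumes a: "a \<ge> 1" and "0 \<le> s" "s \<le> a * (a + 1) / 4"
  shows "bessel_phi a s \<le> exp (- s / a)"
proof -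
  have "bessel_phi a s * exp (s / a) \<le> bessel_phi a 0 * exp (0 / a)"
  proof (rule DERIV_nonpos_imp_nonincreasing[OF assms(2)])
    fix x assume x: "0 \<le> x" "x \<le> s"
    let ?P = "bessel_phi a x" and ?Q = "bessel_phi (a + 1) x"
    have "(a + 2) * (a + 3) \<ge> a * (a + 1)" using a by (intro mult_mono) auto
    then have "0 < bessel_phi (a + 2) x"
      using bessel_phi_pos_and_ratio[of "a + 2" x] a x assms by (simp add: add.assoc)
    then have "0 \<le> x / (a * (a + 1)) * bessel_phi (a + 2) x" using x a by simp
    then have PQ: "?P \<le> ?Q" using bessel_phi_contiguous[OF a, of x] by linarith
    have "((\<lambda>x. bessel_phi a x * exp (x / a)) has_real_derivative
        (?P - ?Q) / a * exp (x / a)) (at x)"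
      by (rule derivative_eq_intros bessel_phi_deriv[OF a] refl | use a in \<open>simp add: field_simps\<close>)+
    moreover have "(?P - ?Q) / a * exp (x / a) \<le> 0"
      using PQ a by (intro mult_nonpos_nonneg divide_nonpos_pos) auto
    ultimately show "\<exists>y. ((\<lambda>x. bessel_phi a x * exp (x / a)) has_real_derivative y) (at x) \<and> y \<le> 0"
      by blast
  qed
  then show ?thesis by (simp add: exp_minus field_simps)
qed

text \<open>The function with parameter \<open>a - 1\<close> has derivative \<open>- bessel_phi a s / (a - 1)\<close>.  A positive lower bound
  for \<open>bessel_phi a\<close> would therefore drive it to minus infinity, although it stays in \<open>[-1, 1]\<close>.\<close>

lemma bessel_phi_lower_bound_nonpos:
  assumes a: "a \<ge> 2" and c: "\<And>s. 0 < s \<Longrightarrow> c \<le> bessel_phi a s"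
  shows "c \<le> 0"
proof (rule ccontr)
  assume "\<not> c \<le> 0"
  then have cp: "c > 0" by simp
  define k where "k = c / (a - 1)"
  have k: "k > 0" using cp a by (simp add: k_def)
  \<comment> \<open>on \<open>[0, T]\<close> a slope of at most \<open>-k\<close> forces a drop by \<open>3\<close>, from \<open>1\<close> to at most \<open>-2\<close>\<close>
  define T where "T = 3 / k"
  have T: "T > 0" using k by (simp add: T_def)
  have "bessel_phi (a - 1) T + k * T \<le> bessel_phi (a - 1) 0 + k * 0"
  proof (rule DERIV_nonpos_imp_decreasing_open[where f = "\<lambda>x. bessel_phi (a - 1) x + k * x"])
    show "0 \<le> T" using T by simp
    fix x assume "0 < x" "x < T"
    have d: "(bessel_phi (a - 1) has_real_derivative - bessel_phi a x / (a - 1)) (at x)" for x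
      using bessel_phi_deriv[of "a - 1" x] a by simp
    have "((\<lambda>x. bessel_phi (a - 1) x + k * x) has_real_derivative
        - bessel_phi a x / (a - 1) + k) (at x)"
      by (auto intro!: derivative_eq_intros d)
    moreover have "- bessel_phi a x / (a - 1) + k \<le> 0"
      using c[OF \<open>0 < x\<close>] a unfolding k_def by (simp add: divide_right_mono)
    ultimately show "\<exists>y. ((\<lambda>x. bessel_phi (a - 1) x + k * x) has_real_derivative y) (at x) \<and> y \<le> 0"
      by blast
  next
    have "continuous_on UNIV (bessel_phi (a - 1))"
      using a by (intro DERIV_continuous_on[OF has_field_derivative_at_within[OF bessel_phi_deriv]]) auto
    then show "continuous_on {0..T} (\<lambda>x. bessel_phi (a - 1) x + k * x)"
      by (intro continuous_intros) (blast intro: continuous_on_subset)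
  qed
  moreover have "k * T = 3" using k by (simp add: T_def)
  ultimately have "bessel_phi (a - 1) T \<le> - 2" by simp
  moreover have "\<bar>bessel_phi (a - 1) T\<bar> \<le> 1"
    using a T by (intro abs_bessel_phi_le_1) auto
  ultimately show False by linarith
qed

lemma normalized_bessel_J_eq_phi:
  assumes "\<nu> \<ge> 0" "u > 0"
  shows "Gamma (\<nu> + 1) * bessel_J \<nu> u / (u / 2) powr \<nu> = bessel_phi (\<nu> + 1) ((u / 2)\<^sup>2)"
proof -
  let ?G = "Gamma (\<nu> + 1)"
  have G: "?G > 0" using assms by (simp add: Gamma_real_pos)
  have t: "(-1) ^ n * (u / 2) ^ (2 * n) / (fact n * Gamma (\<nu> + real n + 1)) =
      inverse ?G * ((-1) ^ n / (fact n * pochhammer (\<nu> + 1) n) * ((u / 2)\<^sup>2) ^ n)" for n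
  proof -
    have "\<nu> + 1 \<notin> \<int>\<^sub>\<le>\<^sub>0" using assms by (auto elim!: nonpos_Ints_cases)
    then have "pochhammer (\<nu> + 1) n = Gamma (\<nu> + real n + 1) / ?G"
      by (simp add: pochhammer_Gamma add_ac)
    then show ?thesis using G by (simp add: power_mult)
  qed
  have "bessel_J \<nu> u = (u / 2) powr \<nu> * (inverse ?G * bessel_phi (\<nu> + 1) ((u / 2)\<^sup>2))"
    unfolding bessel_J_def t bessel_phi_def
    by (subst suminf_mult[OF summable_bessel_phi]) (use assms in simp_all)
  moreover have "?G * inverse ?G = 1" by (rule right_inverse) (use G in linarith)
  moreover have "(u / 2) powr \<nu> \<noteq> 0" using assms by simp
  ultimately show ?thesis by simp
qed

section \<open>Bounds for the Bessel constant\<close>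

lemma lam_eq_INF_bessel_phi:
  "lam d = - (INF s\<in>{0<..}. bessel_phi (real d / 2 + 1) s)"
proof -
  have "(\<lambda>u. Gamma (real d / 2 + 1) * bessel_J (real d / 2) u / (u / 2) powr (real d / 2)) ` {0<..}
      = (\<lambda>u. bessel_phi (real d / 2 + 1) ((u / 2)\<^sup>2)) ` {0<..}"
    by (intro image_cong refl normalized_bessel_J_eq_phi) auto
  also have "\<dots> = bessel_phi (real d / 2 + 1) ` ((\<lambda>u. (u / 2)\<^sup>2) ` {0<..})"
    by (simp add: image_image)
  also have "(\<lambda>u. (u / 2)\<^sup>2) ` {0<..} = ({0<..} :: real set)"
  proof (intro equalityI subsetI)
    fix s :: real assume "s \<in> {0<..}"
    then show "s \<in> (\<lambda>u. (u / 2)\<^sup>2) ` {0<..}"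
      by (intro image_eqI[of _ _ "2 * sqrt s"]) auto
  qed auto
  finally show ?thesis unfolding lam_def by simp
qed

text \<open>The bound by \<open>1\<close> on the absolute value makes the conditionally complete infimum a genuine one.\<close>

lemma lam_ge_neg_bessel_phi:
  assumes "s > 0"
  shows "- bessel_phi (real d / 2 + 1) s \<le> lam d"
proof -
  have "(INF s\<in>{0<..}. bessel_phi (real d / 2 + 1) s) \<le> bessel_phi (real d / 2 + 1) s"
  proof (rule cINF_lower)
    have "- 1 \<le> bessel_phi (real d / 2 + 1) t" if "t > 0" for t
      using abs_bessel_phi_le_1[of "real d / 2 + 1" t] that by simp
    then show "bdd_below (bessel_phi (real d / 2 + 1) ` {0<..})"
      by (intro bdd_belowI2[of _ "-1"]) auto
  qed (use assms in simp)
  then show ?thesis unfolding lam_eq_INF_bessel_phi by simp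
qed

lemma lam_le:
  assumes "\<And>s. s > 0 \<Longrightarrow> - K \<le> bessel_phi (real d / 2 + 1) s"
  shows "lam d \<le> K"
proof -
  have "- K \<le> (INF s\<in>{0<..}. bessel_phi (real d / 2 + 1) s)"
    using assms by (intro cINF_greatest) auto
  then show ?thesis unfolding lam_eq_INF_bessel_phi by simp
qed

text \<open>Otherwise \<open>- lam d\<close> would be a positive lower bound for the normalised Bessel function.\<close>

lemma lam_nonneg:
  assumes "d \<ge> 2"
  shows "0 \<le> lam d"
proof -
  have "- lam d \<le> 0"
    using assms lam_ge_neg_bessel_phi[of _ d]
    by (intro bessel_phi_lower_bound_nonpos[of "real d / 2 + 1"]) (auto simp: minus_le_iff)
  then show ?thesis by simp
qed

text \<open>Up to \<open>s\<close> the function is nonnegative; beyond \<open>s\<close> its oscillations are bounded by the energy at \<open>s\<close>.\<close>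

lemma lam_le_sqrt_energy:
  assumes "0 \<le> s" and "\<And>t. 0 \<le> t \<Longrightarrow> t \<le> s \<Longrightarrow> 0 \<le> bessel_phi (real d / 2 + 1) t"
  shows "lam d \<le> sqrt (bessel_energy (real d / 2 + 1) s)"
proof (rule lam_le)
  fix t :: real assume "t > 0"
  let ?a = "real d / 2 + 1"
  have "0 \<le> bessel_energy ?a s" using assms by (simp add: bessel_energy_def)
  then have e: "0 \<le> sqrt (bessel_energy ?a s)" by simp
  show "- sqrt (bessel_energy ?a s) \<le> bessel_phi ?a t"
  proof (cases "t \<le> s")
    case True
    then have "0 \<le> bessel_phi ?a t" using assms(2) \<open>t > 0\<close> by simp
    then show ?thesis using e by linarith
  next
    case False
    then have "\<bar>bessel_phi ?a t\<bar> \<le> sqrt (bessel_energy ?a s)"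
      using assms by (intro abs_bessel_phi_le_energy) auto
    then show ?thesis by linarith
  qed
qed

text \<open>Replacing the two values in the energy by their quadratic alternating-series bounds leaves a rational
  function of \<open>m\<close>.  It tends to \<open>1 / 4\<close> as \<open>m\<close> grows, so that there is no slack uniformly in \<open>m\<close>; after
  clearing denominators the claim is \<open>8 m (m + 2) + 16 < m (m + 1) (m + 2)^2\<close>.\<close>

lemma bessel_energy_at_a_less:
  assumes m: "m \<ge> 2"
  shows "bessel_energy m m < 1 / 4"
proof -
  let ?p = "m / (2 * (m + 1))" and ?q = "(m\<^sup>2 + 2 * m + 4) / (2 * (m + 1) * (m + 2))"
  have m0: "m > 0" "m + 1 > 0" "m + 2 > 0" using m by auto
  have p: "0 \<le> bessel_phi m m" "bessel_phi m m \<le> ?p"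
    using bessel_phi_bounds[of m m] m by (auto simp: power2_eq_square)
  have "1 - m / (m + 1) + m\<^sup>2 / (2 * (m + 1) * (m + 1 + 1)) = ?q"
    using m0 by (simp add: divide_simps) (simp add: algebra_simps power2_eq_square)
  moreover have "0 \<le> 1 - m / (m + 1)" using m0 by simp
  ultimately have q: "0 \<le> bessel_phi (m + 1) m" "bessel_phi (m + 1) m \<le> ?q"
    using bessel_phi_bounds(1,2)[of "m + 1" m] m by linarith+
  have "bessel_energy m m \<le> ?p\<^sup>2 + m / m\<^sup>2 * ?q\<^sup>2"
    unfolding bessel_energy_def using p q m0
    by (intro add_mono mult_left_mono power_mono) auto
  also have "\<dots> = (m ^ 3 * (m + 2)\<^sup>2 + (m * (m + 2) + 4)\<^sup>2) / (4 * (m * (m + 1)\<^sup>2 * (m + 2)\<^sup>2))"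
  proof -
    have "m\<^sup>2 / (4 * u) + m / m\<^sup>2 * (B / (4 * u * v)) = (m ^ 3 * v + B) / (4 * (m * u * v))"
      if "u > 0" "v > 0" for u v B :: real
      using m0 that by (simp add: divide_simps power2_eq_square power3_eq_cube)
    from this[of "(m + 1)\<^sup>2" "(m + 2)\<^sup>2" "(m * (m + 2) + 4)\<^sup>2"] m0 show ?thesis
      by (simp add: power_divide power_mult_distrib)
        (simp add: power2_eq_square algebra_simps)
  qed
  also have "\<dots> < 1 / 4"
  proof -
    have "8 * m * (m + 2) + 16 < m * (m + 1) * (m + 2)\<^sup>2"
    proof -
      have "(m + 1) * (m + 2) \<ge> 3 * 4" using m by (intro mult_mono) auto
      then have "m * (m + 2) * ((m + 1) * (m + 2)) \<ge> m * (m + 2) * (3 * 4)"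
        using m by (intro mult_left_mono) auto
      moreover have "m * (m + 2) \<ge> 2 * 4" using m by (intro mult_mono) auto
      moreover have "m * (m + 2) * ((m + 1) * (m + 2)) = m * (m + 1) * (m + 2)\<^sup>2"
        by (simp add: power2_eq_square)
      ultimately show ?thesis by simp
    qed
    then have "m ^ 3 * (m + 2)\<^sup>2 + (m * (m + 2) + 4)\<^sup>2 < m * (m + 1)\<^sup>2 * (m + 2)\<^sup>2"
      by (simp add: algebra_simps power2_eq_square power3_eq_cube)
    moreover have "0 < m * (m + 1)\<^sup>2 * (m + 2)\<^sup>2" using m0 by simp
    ultimately show ?thesis by (simp add: divide_less_eq)
  qed
  finally show ?thesis .
qed

text \<open>The point \<open>s = a\<close> is the last one at which the bound \<open>1 - s / a\<close> gives nonnegativity, and there the energy is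
  already below \<open>1 / 4\<close>.\<close>

lemma lam_less_half:
  assumes "d \<ge> 2"
  shows "lam d < 1 / 2"
proof -
  let ?a = "real d / 2 + 1"
  have "0 \<le> bessel_phi ?a t" if "0 \<le> t" "t \<le> ?a" for t
  proof -
    have "t / ?a \<le> 1" using that by (simp add: divide_le_eq)
    moreover have "1 - t / ?a \<le> bessel_phi ?a t" using that by (intro bessel_phi_bounds) auto
    ultimately show ?thesis by linarith
  qed
  then have "lam d \<le> sqrt (bessel_energy ?a ?a)"
    by (intro lam_le_sqrt_energy) auto
  also have "\<dots> < sqrt (1 / 4)"
    using assms by (intro real_sqrt_less_mono bessel_energy_at_a_less) simp
  finally show ?thesis by (simp add: real_sqrt_divide)
qed

text \<open>At \<open>s = a^2 / 4\<close> positivity still holds, while the values with parameters \<open>a\<close> and \<open>a + 1\<close> are both at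
  most \<open>exp (- d / 8)\<close>; hence so is, up to the factor \<open>sqrt 2\<close>, the square root of the energy.\<close>

lemma lam_le_exp:
  "lam d \<le> sqrt 2 * exp (- 1 / 8) ^ d"
proof -
  let ?a = "real d / 2 + 1"
  let ?s = "?a\<^sup>2 / 4"
  have a: "?a \<ge> 1" by simp
  have s: "?s \<le> ?a * (?a + 1) / 4" "?s \<le> (?a + 1) * (?a + 1 + 1) / 4"
    by (simp_all add: field_simps power2_eq_square)
  have pos: "0 \<le> bessel_phi ?a t" if "0 \<le> t" "t \<le> ?s" for t
    using bessel_phi_pos_and_ratio[of ?a t] a s that by linarith
  have P: "0 \<le> bessel_phi ?a ?s" "bessel_phi ?a ?s \<le> exp (- ?s / ?a)"
    using pos[of ?s] bessel_phi_le_exp[of ?a ?s] s by auto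
  have Q: "0 \<le> bessel_phi (?a + 1) ?s" "bessel_phi (?a + 1) ?s \<le> exp (- ?s / (?a + 1))"
    using bessel_phi_pos_and_ratio[of "?a + 1" ?s] bessel_phi_le_exp[of "?a + 1" ?s] s by auto
  have sq: "x\<^sup>2 / 4 / x = x / 4" if "x > 0" for x :: real using that by (simp add: power2_eq_square)
  have "?s / ?a = ?a / 4" by (rule sq) (use a in linarith)
  moreover have "real d / 8 \<le> ?a / 4" by simp
  ultimately have "real d / 8 \<le> ?s / ?a" by (simp only:)
  then have "- (?s / ?a) \<le> - (real d / 8)" by (rule le_imp_neg_le)
  then have "- ?s / ?a \<le> - (real d / 8)" by (subst minus_divide_left[symmetric])
  then have P': "bessel_phi ?a ?s \<le> exp (- (real d / 8))"
    using P by (meson exp_le_cancel_iff order.trans)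
  have "- ?s / (?a + 1) \<le> - (real d / 8)"
  proof -
    have "real d / 8 * (?a + 1) \<le> ?s" by (simp add: power2_eq_square field_simps)
    then have "real d / 8 \<le> ?s / (?a + 1)" by (subst pos_le_divide_eq) auto
    then have "- (?s / (?a + 1)) \<le> - (real d / 8)" by (rule le_imp_neg_le)
    then show ?thesis by (subst minus_divide_left[symmetric])
  qed
  then have Q': "bessel_phi (?a + 1) ?s \<le> exp (- (real d / 8))"
    using Q by (meson exp_le_cancel_iff order.trans)
  have "bessel_energy ?a ?s = (bessel_phi ?a ?s)\<^sup>2 + 1 / 4 * (bessel_phi (?a + 1) ?s)\<^sup>2"
    using a by (simp add: bessel_energy_def add_nonneg_eq_0_iff)
  also have "\<dots> \<le> (exp (- (real d / 8)))\<^sup>2 + 1 * (exp (- (real d / 8)))\<^sup>2"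
    using P P' Q Q' by (intro add_mono mult_mono power_mono) auto
  finally have "bessel_energy ?a ?s \<le> 2 * (exp (- (real d / 8)))\<^sup>2" by simp
  then have "sqrt (bessel_energy ?a ?s) \<le> sqrt (2 * (exp (- (real d / 8)))\<^sup>2)" by simp
  also have "\<dots> = sqrt 2 * exp (- (real d / 8))"
    unfolding real_sqrt_mult real_sqrt_abs by simp
  also have "\<dots> = sqrt 2 * exp (- 1 / 8) ^ d"
    by (simp add: exp_of_nat_mult[symmetric])
  finally show ?thesis
    using lam_le_sqrt_energy[of ?s d] pos by simp
qed

section \<open>Scaling and exchange of integrals\<close>

lemma nn_integral_scaleR:
  fixes g :: "'a::euclidean_space \<Rightarrow> ennreal"
  assumes [measurable]: "g \<in> borel_measurable borel" and c: "c \<noteq> 0"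
  shows "(\<integral>\<^sup>+x. g x \<partial>lborel) = ennreal (\<bar>c\<bar> ^ DIM('a)) * (\<integral>\<^sup>+x. g (t + c *\<^sub>R x) \<partial>lborel)"
  by (subst lborel_affine[OF c, of t]) (simp add: nn_integral_density nn_integral_distr nn_integral_cmult)

lemma integral_scaleR:
  fixes g :: "'a::euclidean_space \<Rightarrow> real"
  assumes [measurable]: "g \<in> borel_measurable borel" and c: "c \<noteq> 0"
  shows "(\<integral>x. g x \<partial>lborel) = \<bar>c\<bar> ^ DIM('a) * (\<integral>x. g (t + c *\<^sub>R x) \<partial>lborel)"
  by (subst lborel_affine[OF c, of t]) (simp add: integral_density integral_distr)

lemma integrable_scaleR:
  fixes g :: "'a::euclidean_space \<Rightarrow> real"
  assumes g: "integrable lborel g" and c: "c \<noteq> 0"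
  shows "integrable lborel (\<lambda>x. g (t + c *\<^sub>R x))"
proof -
  have [measurable]: "g \<in> borel_measurable borel" using g by auto
  have "ennreal (\<bar>c\<bar> ^ DIM('a)) * (\<integral>\<^sup>+x. norm (g (t + c *\<^sub>R x)) \<partial>lborel) < \<infinity>"
    using g nn_integral_scaleR[of "\<lambda>x. norm (g x)" c t] c by (simp add: integrable_iff_bounded)
  then have "(\<integral>\<^sup>+x. norm (g (t + c *\<^sub>R x)) \<partial>lborel) < \<infinity>"
    using c by (auto simp: ennreal_mult_less_top)
  then show ?thesis by (simp add: integrable_iff_bounded)
qed

lemma integral_bounded_kernel_swap:
  fixes f :: "'a::euclidean_space \<Rightarrow> real" and g :: "'b::euclidean_space \<Rightarrow> real"
  assumes f: "integrable lborel f" and g: "integrable lborel g"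
    and h: "case_prod h \<in> borel_measurable (borel \<Otimes>\<^sub>M borel)" and bd: "\<And>x y. \<bar>h x y\<bar> \<le> (1::real)"
  shows "(\<integral>y. (\<integral>x. f x * g y * h x y \<partial>lborel) \<partial>lborel) = (\<integral>x. (\<integral>y. f x * g y * h x y \<partial>lborel) \<partial>lborel)"
proof (rule lborel_pair.Fubini_integral, rule Bochner_Integration.integrable_bound)
  have [measurable]: "f \<in> borel_measurable borel" "g \<in> borel_measurable borel" using f g by auto
  note h[measurable]
  show "integrable (lborel \<Otimes>\<^sub>M lborel) (\<lambda>p. f (fst p) * g (snd p))"
  proof (rule lborel_pair.Fubini_integrable)
    show "integrable lborel (\<lambda>x. \<integral>y. norm (f (fst (x, y)) * g (snd (x, y))) \<partial>lborel)"
      using f by (simp add: abs_mult)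
    show "AE x in lborel. integrable lborel (\<lambda>y. f (fst (x, y)) * g (snd (x, y)))"
      using g by simp
  qed measurable
  show "(\<lambda>(x, y). f x * g y * h x y) \<in> borel_measurable (lborel \<Otimes>\<^sub>M lborel)"
    by measurable
  show "AE p in lborel \<Otimes>\<^sub>M lborel. norm (case p of (x, y) \<Rightarrow> f x * g y * h x y)
      \<le> norm (f (fst p) * g (snd p))"
    unfolding split_beta abs_mult real_norm_def by (intro AE_I2 mult_left_le bd) simp
qed

section \<open>The Gaussian\<close>

text \<open>The standard Gaussian density, introduced as a product so that Fubini on coordinates applies at once.\<close>

definition gauss :: "'a::euclidean_space \<Rightarrow> real" where
  "gauss x = (\<Prod>b\<in>Basis. std_normal_density (x \<bullet> b))"

lemma gauss_eq:
  "gauss (x :: 'a::euclidean_space) = exp (- (norm x)\<^sup>2 / 2) / sqrt (2 * pi) ^ DIM('a)"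
proof -
  have "(norm x)\<^sup>2 = (\<Sum>b\<in>Basis. (x \<bullet> b)\<^sup>2)"
    by (simp add: power2_norm_eq_inner euclidean_inner[of x x] power2_eq_square[of "x \<bullet> _"])
  then have "exp (- (norm x)\<^sup>2 / 2) = (\<Prod>b\<in>Basis. exp (- (x \<bullet> b)\<^sup>2 / 2))"
    by (simp add: exp_sum sum_negf[symmetric] sum_divide_distrib)
  then show ?thesis
    unfolding gauss_def std_normal_density_def prod.distrib by (simp add: power_one_over)
qed

lemma gauss_pos: "0 < gauss x" unfolding gauss_eq by simp
lemma gauss_nonneg [simp]: "0 \<le> gauss x" using gauss_pos[of x] by simp

lemma borel_measurable_gauss [measurable]: "gauss \<in> borel_measurable borel"
  unfolding gauss_def[abs_def] by measurable

abbreviation gauss_measure :: "'a::euclidean_space measure" where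
  "gauss_measure \<equiv> density lborel gauss"

lemma prob_space_gauss_measure: "prob_space (gauss_measure :: 'a::euclidean_space measure)"
proof
  have "emeasure (gauss_measure :: 'a measure) (space gauss_measure) =
      (\<integral>\<^sup>+x. (\<Prod>b\<in>Basis. ennreal (std_normal_density (x \<bullet> b))) \<partial>(lborel :: 'a measure))"
    by (simp add: emeasure_density gauss_def prod_ennreal)
  also have "\<dots> = (\<Prod>b\<in>(Basis :: 'a set). (\<integral>\<^sup>+x. ennreal (std_normal_density x) \<partial>lborel))"
    by (rule nn_integral_lborel_prod) auto
  also have "(\<integral>\<^sup>+x. ennreal (std_normal_density x) \<partial>lborel) = 1"
    using prob_space.emeasure_space_1[OF prob_space_normal_density[of 1 0]]
    by (simp add: emeasure_density)
  finally show "emeasure (gauss_measure :: 'a measure) (space gauss_measure) = 1" by simp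
qed

lemma integrable_gauss: "integrable lborel (gauss :: 'a::euclidean_space \<Rightarrow> real)"
  and integral_gauss: "(\<integral>x. gauss x \<partial>(lborel :: 'a measure)) = 1"
proof -
  interpret prob_space "gauss_measure :: 'a measure" by (rule prob_space_gauss_measure)
  have "(\<integral>\<^sup>+x. ennreal (gauss x) \<partial>(lborel :: 'a measure)) = 1"
    using emeasure_space_1 by (simp add: emeasure_density)
  then show "integrable lborel (gauss :: 'a \<Rightarrow> real)" "(\<integral>x. gauss x \<partial>(lborel :: 'a measure)) = 1"
    by (auto intro!: integrableI_nonneg simp: integral_eq_nn_integral)
qed

lemma integral_lborel_prod:
  fixes f :: "'a::euclidean_space \<Rightarrow> real \<Rightarrow> complex"
  assumes int: "\<And>b. b \<in> Basis \<Longrightarrow> integrable lborel (f b)"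
  shows "(\<integral>x. (\<Prod>b\<in>Basis. f b (x \<bullet> b)) \<partial>(lborel :: 'a measure)) = (\<Prod>b\<in>Basis. \<integral>x. f b x \<partial>lborel)"
proof -
  interpret product_sigma_finite "\<lambda>_::'a. lborel :: real measure" ..
  have [measurable]: "f b \<in> borel_measurable borel" if "b \<in> Basis" for b using int[OF that] by auto
  have "(\<integral>x. (\<Prod>b\<in>Basis. f b (x \<bullet> b)) \<partial>(lborel :: 'a measure)) =
      (\<integral>x. (\<Prod>b\<in>Basis. f b ((\<Sum>c\<in>Basis. x c *\<^sub>R c) \<bullet> b)) \<partial>(\<Pi>\<^sub>M b\<in>(Basis::'a set). (lborel :: real measure)))"
    by (subst lborel_eq, subst integral_distr) auto
  also have "\<dots> = (\<integral>x. (\<Prod>b\<in>Basis. f b (x b)) \<partial>(\<Pi>\<^sub>M b\<in>(Basis::'a set). (lborel :: real measure)))"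
    by (intro Bochner_Integration.integral_cong refl prod.cong) simp_all
  also have "\<dots> = (\<Prod>b\<in>Basis. \<integral>x. f b x \<partial>lborel)"
    by (rule product_integral_prod) (use int in auto)
  finally show ?thesis .
qed

text \<open>The integrand factors over the coordinates, and each factor is the characteristic function of the
  one-dimensional standard normal distribution.\<close>

lemma integral_gauss_iexp:
  fixes y :: "'a::euclidean_space"
  shows "(\<integral>x. complex_of_real (gauss x) * iexp (x \<bullet> y) \<partial>lborel) = exp (- (norm y)\<^sup>2 / 2)"
proof -
  have 1: "complex_of_real (gauss x) * iexp (x \<bullet> y) =
      (\<Prod>b\<in>Basis. complex_of_real (std_normal_density (x \<bullet> b)) * iexp ((y \<bullet> b) * (x \<bullet> b)))" for x
    unfolding gauss_def by (subst euclidean_inner)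
      (simp add: prod.distrib exp_sum[symmetric] sum_distrib_left mult_ac)
  have 2: "(\<integral>z. complex_of_real (std_normal_density z) * iexp (t * z) \<partial>lborel) = exp (- t\<^sup>2 / 2)" for t
  proof -
    have "char std_normal_distribution t =
        (\<integral>z. std_normal_density z *\<^sub>R iexp (t * z) \<partial>lborel)"
      unfolding char_def by (subst integral_density) auto
    then show ?thesis unfolding char_std_normal_distribution by (simp add: scaleR_conv_of_real)
  qed
  have int: "integrable lborel (\<lambda>z. complex_of_real (std_normal_density z) * iexp (t * z))" for t
    by (rule Bochner_Integration.integrable_bound[of _ "\<lambda>z. std_normal_density z"])
      (auto simp: norm_mult integrable_normal_density)
  have "(\<integral>x. complex_of_real (gauss x) * iexp (x \<bullet> y) \<partial>lborel) =
      (\<Prod>b\<in>Basis. complex_of_real (exp (- (y \<bullet> b)\<^sup>2 / 2)))"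
    unfolding 1 by (subst integral_lborel_prod[OF int]) (simp only: 2)
  also have "\<dots> = exp (- (norm y)\<^sup>2 / 2)"
    unfolding power2_norm_eq_inner
    by (subst euclidean_inner)
      (simp add: of_real_prod[symmetric] exp_sum[symmetric] sum_negf sum_divide_distrib power2_eq_square del: of_real_prod)
  finally show ?thesis .
qed

lemma integrable_gauss_iexp:
  fixes y :: "'a::euclidean_space"
  shows "integrable lborel (\<lambda>x. complex_of_real (gauss x) * iexp (x \<bullet> y))"
  by (rule Bochner_Integration.integrable_bound[OF integrable_gauss]) (auto simp: norm_mult)

lemma integral_gauss_cos:
  fixes y :: "'a::euclidean_space"
  shows "(\<integral>x. gauss x * cos (x \<bullet> y) \<partial>lborel) = exp (- (norm y)\<^sup>2 / 2)"
proof -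
  have "(\<integral>x. gauss x * cos (x \<bullet> y) \<partial>lborel) =
      Re (\<integral>x. complex_of_real (gauss x) * iexp (x \<bullet> y) \<partial>lborel)"
    by (subst integral_Re[OF integrable_gauss_iexp, symmetric]) (simp add: Re_exp)
  then show ?thesis unfolding integral_gauss_iexp by simp
qed

text \<open>A linear functional of a Gaussian vector is a scaled normal variable, since the characteristic functions
  agree.  This takes the place of an argument by rotation invariance.\<close>

lemma distr_gauss_inner:
  fixes y :: "'a::euclidean_space"
  shows "distr gauss_measure borel (\<lambda>x. x \<bullet> y) = distr std_normal_distribution borel (\<lambda>z. norm y * z)"
proof (rule Levy_uniqueness)
  interpret G: prob_space "gauss_measure :: 'a measure" by (rule prob_space_gauss_measure)
  interpret N: real_distribution std_normal_distribution by (rule real_dist_normal_dist)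
  show "real_distribution (distr gauss_measure borel (\<lambda>x. x \<bullet> y))"
    by (rule G.real_distribution_distr) simp
  show "real_distribution (distr std_normal_distribution borel (\<lambda>z. norm y * z))"
    by (rule N.real_distribution_distr) simp
  show "char (distr gauss_measure borel (\<lambda>x. x \<bullet> y)) =
      char (distr std_normal_distribution borel (\<lambda>z. norm y * z))"
  proof
    fix t
    have "char (distr gauss_measure borel (\<lambda>x. x \<bullet> y)) t =
        (\<integral>x. gauss x *\<^sub>R iexp (t * (x \<bullet> y)) \<partial>lborel)"
      unfolding char_def by (simp add: integral_distr integral_density)
    also have "\<dots> = (\<integral>x. complex_of_real (gauss x) * iexp (x \<bullet> (t *\<^sub>R y)) \<partial>lborel)"
      by (simp add: scaleR_conv_of_real)
    also have "\<dots> = exp (- (norm (t *\<^sub>R y))\<^sup>2 / 2)" by (rule integral_gauss_iexp)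
    also have "\<dots> = char std_normal_distribution (t * norm y)"
      unfolding char_std_normal_distribution by (simp add: power_mult_distrib)
    also have "\<dots> = char (distr std_normal_distribution borel (\<lambda>z. norm y * z)) t"
      unfolding char_def by (simp add: integral_distr mult.assoc)
    finally show "char (distr gauss_measure borel (\<lambda>x. x \<bullet> y)) t =
        char (distr std_normal_distribution borel (\<lambda>z. norm y * z)) t" .
  qed
qed

lemma nn_integral_gauss_inner_power:
  fixes y :: "'a::euclidean_space"
  shows "(\<integral>\<^sup>+x. ennreal (gauss x * (x \<bullet> y) ^ (2 * k)) \<partial>lborel) =
      ennreal (norm y ^ (2 * k) * (fact (2 * k) / (2 ^ k * fact k)))"
proof -
  have "(\<integral>\<^sup>+x. ennreal (gauss x * (x \<bullet> y) ^ (2 * k)) \<partial>lborel) =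
      (\<integral>\<^sup>+w. ennreal (w ^ (2 * k)) \<partial>distr gauss_measure borel (\<lambda>x. x \<bullet> y))"
    by (simp add: nn_integral_distr nn_integral_density ennreal_mult'[symmetric])
  also have "\<dots> = (\<integral>\<^sup>+z. ennreal (std_normal_density z * (norm y * z) ^ (2 * k)) \<partial>lborel)"
    unfolding distr_gauss_inner
    by (simp add: nn_integral_distr nn_integral_density ennreal_mult'[symmetric])
  also have "\<dots> = (\<integral>\<^sup>+z. ennreal (norm y ^ (2 * k) * (std_normal_density z * z ^ (2 * k))) \<partial>lborel)"
    by (simp add: power_mult_distrib mult_ac)
  also have "\<dots> = ennreal (\<integral>z. norm y ^ (2 * k) * (std_normal_density z * z ^ (2 * k)) \<partial>lborel)"
    by (intro nn_integral_eq_integral integrable_mult_right integrable_std_normal_moment AE_I2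
        mult_nonneg_nonneg) (auto simp: power_mult)
  also have "\<dots> = ennreal (norm y ^ (2 * k) * (fact (2 * k) / (2 ^ k * fact k)))"
    using integral_std_normal_moment_even[of k] by simp
  finally show ?thesis .
qed

section \<open>The Fourier transform of a ball\<close>

lemma nn_integral_exp_tail:
  "(\<integral>\<^sup>+s. ennreal (exp (- s)) * indicator {q..} s \<partial>lborel) = ennreal (exp (- q))"
proof -
  have "((\<lambda>x::real. - exp (- x)) \<longlongrightarrow> - 0) at_top"
    by (intro tendsto_minus filterlim_compose[OF exp_at_bot] filterlim_uminus_at_bot_at_top)
  then have "(\<integral>\<^sup>+s. ennreal (exp (- s)) * indicator {q..} s \<partial>lborel) = ennreal (0 - (- exp (- q)))"
    by (intro nn_integral_FTC_atLeast) (auto intro!: derivative_eq_intros)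
  then show ?thesis by simp
qed

lemma nn_integral_cball_scale:
  fixes y :: "'a::euclidean_space"
  assumes "R > 0"
  shows "(\<integral>\<^sup>+x. ennreal ((x \<bullet> y) ^ (2 * k)) * indicator (cball 0 R) x \<partial>lborel) =
    ennreal (R ^ (2 * k + DIM('a))) *
      (\<integral>\<^sup>+x. ennreal ((x \<bullet> y) ^ (2 * k)) * indicator (cball 0 1) x \<partial>lborel)"
proof -
  have [measurable]: "cball (0::'a) r \<in> sets borel" for r by simp
  have ind: "indicator (cball 0 R) (R *\<^sub>R x) = (indicator (cball 0 1) x :: ennreal)" for x :: 'a
    using assms by (auto simp: indicator_def)
  have "(\<integral>\<^sup>+x. ennreal ((x \<bullet> y) ^ (2 * k)) * indicator (cball 0 R) x \<partial>lborel) =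
      ennreal (R ^ DIM('a)) *
        (\<integral>\<^sup>+x. ennreal (R ^ (2 * k)) * (ennreal ((x \<bullet> y) ^ (2 * k)) * indicator (cball 0 1) x) \<partial>lborel)"
    using assms
    by (subst nn_integral_scaleR[of _ R 0], measurable)
      (simp_all add: ind power_mult_distrib ennreal_mult' mult.assoc)
  also have "\<dots> = ennreal (R ^ DIM('a)) * (ennreal (R ^ (2 * k)) *
      (\<integral>\<^sup>+x. ennreal ((x \<bullet> y) ^ (2 * k)) * indicator (cball 0 1) x \<partial>lborel))"
    by (subst nn_integral_cmult) simp_all
  also have "\<dots> = ennreal (R ^ (2 * k + DIM('a))) *
      (\<integral>\<^sup>+x. ennreal ((x \<bullet> y) ^ (2 * k)) * indicator (cball 0 1) x \<partial>lborel)"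
    using assms by (simp add: power_add ennreal_mult' mult_ac)
  finally show ?thesis .
qed

lemma nn_integral_exp_radial_power:
  "(\<integral>\<^sup>+s. ennreal (indicator {0..} s * (sqrt (2 * s) ^ n * exp (- s))) \<partial>lborel) =
    ennreal (2 powr (n / 2) * Gamma (n / 2 + 1))"
proof -
  have "(\<integral>\<^sup>+s. ennreal (indicator {0..} s * (sqrt (2 * s) ^ n * exp (- s))) \<partial>lborel) =
      (\<integral>\<^sup>+s. ennreal (2 powr (n / 2)) *
        ennreal (indicator {0..} s * s powr ((n / 2 + 1) - 1) / exp s) \<partial>lborel)"
  proof (rule nn_integral_cong_AE)
    \<comment> \<open>for \<open>n = 0\<close> the two sides differ at \<open>s = 0\<close>, since \<open>0 ^ 0 = 1\<close> but \<open>0 powr 0 = 0\<close>\<close>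
    have "AE s in lborel. s \<noteq> (0::real)" by (rule AE_lborel_singleton)
    then show "AE s in lborel. ennreal (indicator {0..} s * (sqrt (2 * s) ^ n * exp (- s))) =
        ennreal (2 powr (n / 2)) * ennreal (indicator {0..} s * s powr ((n / 2 + 1) - 1) / exp s)"
    proof eventually_elim
      case (elim s)
      have "sqrt (2 * s) ^ n = 2 powr (n / 2) * s powr (n / 2)" if "s > 0"
        using that by (simp add: powr_mult[symmetric] powr_half_sqrt[symmetric] powr_powr powr_realpow[symmetric])
      then show ?case using elim
        by (auto simp: indicator_def exp_minus field_simps ennreal_mult'[symmetric])
    qed
  qed
  also have "\<dots> = ennreal (2 powr (n / 2)) * ennreal (Gamma (n / 2 + 1))"
    by (subst nn_integral_cmult) (simp_all add: Gamma_conv_nn_integral_real)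
  also have "\<dots> = ennreal (2 powr (n / 2) * Gamma (n / 2 + 1))"
    by (simp add: ennreal_mult')
  finally show ?thesis .
qed

text \<open>Layer-cake comparison with the Gaussian: \<open>exp (- norm x ^ 2 / 2)\<close> is the integral of \<open>exp (- s)\<close> over
  \<open>s \<ge> norm x ^ 2 / 2\<close>, that is, a superposition of indicators of balls of radius \<open>sqrt (2 * s)\<close>.  By homogeneity the
  moment of each ball is a power of its radius times the moment of the unit ball, so the known Gaussian moment is
  the unknown ball moment times a Gamma integral.\<close>

lemma nn_integral_unit_ball_moment:
  fixes y :: "'a::euclidean_space"
  defines "d \<equiv> DIM('a)"
  shows "(\<integral>\<^sup>+x. ennreal ((x \<bullet> y) ^ (2 * k)) * indicator (cball 0 1) x \<partial>lborel) =
    ennreal (unit_ball_vol d *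
      (fact (2 * k) * (norm y / 2) ^ (2 * k) / (fact k * pochhammer (d / 2 + 1) k)))"
proof -
  let ?m = "\<integral>\<^sup>+x. ennreal ((x \<bullet> y) ^ (2 * k)) * indicator (cball 0 1) x \<partial>lborel"
  let ?n = "2 * k + d"
  let ?C = "sqrt (2 * pi) ^ d"
  let ?K = "2 powr (?n / 2) * Gamma (?n / 2 + 1)"
  let ?L = "?C * (norm y ^ (2 * k) * (fact (2 * k) / (2 ^ k * fact k)))"
  have ge0: "(z :: real) ^ (2 * k) \<ge> 0" for z by (simp add: power_mult)
  have "ennreal ?L = ennreal ?C * (\<integral>\<^sup>+x. ennreal (gauss x * (x \<bullet> y) ^ (2 * k)) \<partial>lborel)"
    unfolding nn_integral_gauss_inner_power by (rule ennreal_mult') simp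
  also have "\<dots> = (\<integral>\<^sup>+x. ennreal ((x \<bullet> y) ^ (2 * k)) * ennreal (exp (- ((norm x)\<^sup>2 / 2))) \<partial>lborel)"
  proof (subst nn_integral_cmult[symmetric])
    have "ennreal ?C * ennreal (gauss x * (x \<bullet> y) ^ (2 * k)) =
        ennreal ((x \<bullet> y) ^ (2 * k) * exp (- ((norm x)\<^sup>2 / 2)))" for x
      by (subst ennreal_mult'[symmetric]) (simp_all add: gauss_eq d_def)
    then show "(\<integral>\<^sup>+x. ennreal ?C * ennreal (gauss x * (x \<bullet> y) ^ (2 * k)) \<partial>lborel) =
        (\<integral>\<^sup>+x. ennreal ((x \<bullet> y) ^ (2 * k)) * ennreal (exp (- ((norm x)\<^sup>2 / 2))) \<partial>lborel)"
      by (simp add: ennreal_mult'')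
  qed simp
  also have "\<dots> = (\<integral>\<^sup>+x. (\<integral>\<^sup>+s. ennreal ((x \<bullet> y) ^ (2 * k)) *
      (ennreal (exp (- s)) * indicator {(norm x)\<^sup>2 / 2..} s) \<partial>lborel) \<partial>lborel)"
    by (subst nn_integral_cmult) (simp_all only: nn_integral_exp_tail, simp)
  also have "\<dots> = (\<integral>\<^sup>+s. (\<integral>\<^sup>+x. ennreal ((x \<bullet> y) ^ (2 * k)) *
      (ennreal (exp (- s)) * indicator {(norm x)\<^sup>2 / 2..} s) \<partial>lborel) \<partial>lborel)"
  proof (rule lborel_pair.Fubini'[symmetric])
    have ind: "indicator {q..} s = (if q \<le> s then 1 else 0 :: ennreal)" for q s :: real
      by (simp add: indicator_def)
    show "(\<lambda>(x, s). ennreal ((x \<bullet> y) ^ (2 * k)) *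
        (ennreal (exp (- s)) * indicator {(norm x)\<^sup>2 / 2..} s)) \<in> borel_measurable (lborel \<Otimes>\<^sub>M lborel)"
      unfolding ind by measurable
  qed
  also have "\<dots> = (\<integral>\<^sup>+s. ennreal (indicator {0..} s * (sqrt (2 * s) ^ ?n * exp (- s))) * ?m \<partial>lborel)"
  proof (rule nn_integral_cong_AE)
    \<comment> \<open>scaling to the unit ball needs a positive radius \<open>sqrt (2 * s)\<close>\<close>
    have "AE s in lborel. s \<noteq> (0::real)" by (rule AE_lborel_singleton)
    then show "AE s in lborel. (\<integral>\<^sup>+x. ennreal ((x \<bullet> y) ^ (2 * k)) *
      (ennreal (exp (- s)) * indicator {(norm x)\<^sup>2 / 2..} s) \<partial>lborel) =
      ennreal (indicator {0..} s * (sqrt (2 * s) ^ ?n * exp (- s))) * ?m"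
    proof eventually_elim
      case (elim s)
      have [measurable]: "cball (0::'a) r \<in> sets borel" for r by simp
      show ?case
      proof (cases "s > 0")
        case True
        have ind: "indicator {(norm x)\<^sup>2 / 2..} s = (indicator (cball 0 (sqrt (2 * s))) x :: ennreal)" for x :: 'a
        proof -
          have "(norm x)\<^sup>2 / 2 \<le> s \<longleftrightarrow> sqrt ((norm x)\<^sup>2) \<le> sqrt (2 * s)"
            unfolding real_sqrt_le_iff by linarith
          then show ?thesis by (simp add: indicator_def)
        qed
        have "(\<integral>\<^sup>+x. ennreal ((x \<bullet> y) ^ (2 * k)) *
            (ennreal (exp (- s)) * indicator {(norm x)\<^sup>2 / 2..} s) \<partial>lborel) =
          (\<integral>\<^sup>+x. ennreal (exp (- s)) * (ennreal ((x \<bullet> y) ^ (2 * k)) *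
            indicator (cball 0 (sqrt (2 * s))) x) \<partial>lborel)"
          by (intro nn_integral_cong) (simp only: ind mult_ac)
        also have "\<dots> = ennreal (exp (- s)) * (ennreal (sqrt (2 * s) ^ ?n) * ?m)"
        proof (subst nn_integral_cmult)
          have "sqrt (2 * s) > 0" using True by simp
          from nn_integral_cball_scale[OF this, of y k]
          show "ennreal (exp (- s)) * (\<integral>\<^sup>+x. ennreal ((x \<bullet> y) ^ (2 * k)) *
              indicator (cball 0 (sqrt (2 * s))) x \<partial>lborel) =
            ennreal (exp (- s)) * (ennreal (sqrt (2 * s) ^ ?n) * ?m)"
            by (simp only: d_def)
        qed measurable
        also have "\<dots> = ennreal (indicator {0..} s * (sqrt (2 * s) ^ ?n * exp (- s))) * ?m"
          using True by (simp add: ennreal_mult' mult_ac)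
        finally show ?thesis .
      next
        case False
        have "indicator {(norm x)\<^sup>2 / 2..} s = (0 :: ennreal)" for x :: 'a
        proof -
          have "s < 0" "0 \<le> (norm x)\<^sup>2 / 2" using False elim by auto
          then have "s \<notin> {(norm x)\<^sup>2 / 2..}" unfolding atLeast_iff by linarith
          then show ?thesis by simp
        qed
        then have "(\<integral>\<^sup>+x. ennreal ((x \<bullet> y) ^ (2 * k)) *
            (ennreal (exp (- s)) * indicator {(norm x)\<^sup>2 / 2..} s) \<partial>lborel) = 0"
          by simp
        moreover have "indicator {0..} s = (0 :: real)" using False elim by simp
        ultimately show ?thesis by simp
      qed
    qed
  qed
  also have "\<dots> = ennreal ?K * ?m"
    by (subst nn_integral_multc) (auto simp: nn_integral_exp_radial_power)
  finally have KL: "ennreal ?K * ?m = ennreal ?L" ..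
  have K: "?K > 0" by (intro mult_pos_pos Gamma_real_pos add_nonneg_pos) simp_all
  have "m = ennreal (L / K)" if "ennreal K * m = ennreal L" "K > 0" for K L :: real and m
  proof -
    have "m = ennreal (1 / K) * (ennreal K * m)"
      using that(2) by (simp add: mult.assoc[symmetric] ennreal_mult'[symmetric])
    also have "\<dots> = ennreal (L / K)"
      unfolding that(1) using that(2) by (simp add: ennreal_mult'[symmetric])
    finally show ?thesis .
  qed
  from this[OF KL K] have "?m = ennreal (?L / ?K)" .
  also have "?L / ?K = unit_ball_vol d *
      (fact (2 * k) * (norm y / 2) ^ (2 * k) / (fact k * pochhammer (d / 2 + 1) k))"
  proof -
    have G: "Gamma (real d / 2 + 1) > 0" by (simp add: Gamma_real_pos)
    have "real d / 2 + 1 \<notin> \<int>\<^sub>\<le>\<^sub>0" by (auto elim!: nonpos_Ints_cases)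
    then have po: "pochhammer (real d / 2 + 1) k = Gamma (?n / 2 + 1) / Gamma (real d / 2 + 1)"
      by (simp add: pochhammer_Gamma add_ac add_divide_distrib)
    have C: "?C = 2 powr (d / 2) * pi powr (d / 2)"
      by (simp add: powr_mult[symmetric] powr_half_sqrt[symmetric] powr_powr powr_realpow[symmetric])
    have P: "2 powr (?n / 2) = 2 powr (real d / 2) * 2 ^ k"
      by (simp add: powr_add powr_realpow add_divide_distrib)
    have T: "(norm y / 2) ^ (2 * k) = norm y ^ (2 * k) / (2 ^ k * 2 ^ k)"
      by (simp add: power_divide power_add mult_2)
    have "A * B * (Y * (F / (t * Fk))) / (A * t * G1) = B / G0 * (F * (Y / (t * t)) / (Fk * (G1 / G0)))"
      if "A > 0" "t > 0" "G0 > 0" "G1 > 0" "Fk > 0" for A B Y F t Fk G0 G1 :: real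
      using that by (simp add: field_simps)
    note * = this[of "2 powr (d / 2)" "2 ^ k" "Gamma (real d / 2 + 1)" "Gamma (?n / 2 + 1)" "fact k"
        "pi powr (d / 2)" "norm y ^ (2 * k)" "fact (2 * k)"]
    show ?thesis
      unfolding C po P T unit_ball_vol_def
      by (rule *) (simp_all only: G, auto intro!: Gamma_real_pos add_nonneg_pos)
  qed
  finally show ?thesis .
qed

lemma
  fixes y :: "'a::euclidean_space"
  assumes R: "R > 0"
  shows integrable_ball_moment: "integrable lborel (\<lambda>x. indicator (cball 0 R) x * (x \<bullet> y) ^ (2 * k))"
    and integral_ball_moment: "(\<integral>x. indicator (cball 0 R) x * (x \<bullet> y) ^ (2 * k) \<partial>lborel) =
      unit_ball_vol DIM('a) * R ^ DIM('a) *
      (fact (2 * k) * (R * norm y / 2) ^ (2 * k) / (fact k * pochhammer (DIM('a) / 2 + 1) k))"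
proof -
  let ?d = "DIM('a)"
  let ?v = "unit_ball_vol ?d * R ^ ?d *
      (fact (2 * k) * (R * norm y / 2) ^ (2 * k) / (fact k * pochhammer (?d / 2 + 1) k))"
  have "(\<integral>\<^sup>+x. ennreal (indicator (cball 0 R) x * (x \<bullet> y) ^ (2 * k)) \<partial>lborel) =
      (\<integral>\<^sup>+x. ennreal ((x \<bullet> y) ^ (2 * k)) * indicator (cball 0 R) x \<partial>lborel)"
    by (intro nn_integral_cong) (auto simp: indicator_def)
  also have "\<dots> = ennreal ?v"
    unfolding nn_integral_cball_scale[OF R] nn_integral_unit_ball_moment
    using R by (simp add: ennreal_mult'[symmetric] power_add power_mult_distrib power_divide mult_ac)
  finally have nn: "(\<integral>\<^sup>+x. ennreal (indicator (cball 0 R) x * (x \<bullet> y) ^ (2 * k)) \<partial>lborel) = ennreal ?v" .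
  have [measurable]: "cball (0::'a) R \<in> sets borel" by simp
  have ge0: "0 \<le> indicator (cball 0 R) x * (x \<bullet> y) ^ (2 * k)" for x
    by (simp add: power_mult)
  show "integrable lborel (\<lambda>x. indicator (cball 0 R) x * (x \<bullet> y) ^ (2 * k))"
  proof (rule integrableI_nonneg)
    show "(\<lambda>x. indicator (cball 0 R) x * (x \<bullet> y) ^ (2 * k)) \<in> borel_measurable lborel"
      by measurable
    show "AE x in lborel. 0 \<le> indicator (cball 0 R) x * (x \<bullet> y) ^ (2 * k)"
      using ge0 by (rule AE_I2)
    show "(\<integral>\<^sup>+x. ennreal (indicator (cball 0 R) x * (x \<bullet> y) ^ (2 * k)) \<partial>lborel) < \<infinity>"
      unfolding nn by simp
  qed
  have "0 < pochhammer (real ?d / 2 + 1) k" using pochhammer_ge_1[of "real ?d / 2 + 1" k] by linarith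
  then have "?v \<ge> 0" using R by simp
  then show "(\<integral>x. indicator (cball 0 R) x * (x \<bullet> y) ^ (2 * k) \<partial>lborel) = ?v"
  proof (subst integral_eq_nn_integral)
    show "(\<lambda>x. indicator (cball 0 R) x * (x \<bullet> y) ^ (2 * k)) \<in> borel_measurable lborel"
      by measurable
    show "AE x in lborel. 0 \<le> indicator (cball 0 R) x * (x \<bullet> y) ^ (2 * k)"
      using ge0 by (rule AE_I2)
    show "enn2real (\<integral>\<^sup>+x. ennreal (indicator (cball 0 R) x * (x \<bullet> y) ^ (2 * k)) \<partial>lborel) = ?v"
      unfolding nn by (rule enn2real_ennreal) fact
  qed
qed

text \<open>Expand the cosine and integrate term by term; the moments of the ball, divided by the factorials \<open>fact (2 * k)\<close> of the
  cosine series, are the coefficients of the Bessel series.  The integrals of the absolute values form the same series at \<open>-s\<close>, which justifies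
  the exchange.\<close>

lemma integral_ball_cos:
  fixes y :: "'a::euclidean_space"
  assumes R: "R > 0"
  shows "(\<integral>x. indicator (cball 0 R) x * cos (x \<bullet> y) \<partial>lborel) =
    unit_ball_vol DIM('a) * R ^ DIM('a) * bessel_phi (DIM('a) / 2 + 1) ((R * norm y / 2)\<^sup>2)"
proof -
  let ?d = "DIM('a)"
  let ?a = "real ?d / 2 + 1"
  let ?V = "unit_ball_vol ?d * R ^ ?d"
  let ?s = "(R * norm y / 2)\<^sup>2"
  let ?f = "\<lambda>k x. (-1) ^ k / fact (2 * k) * (indicator (cball 0 R) x * (x \<bullet> y) ^ (2 * k)) :: real"
  let ?t = "\<lambda>s k. (-1) ^ k / (fact k * pochhammer ?a k) * s ^ k :: real"
  have int: "integrable lborel (?f k)" for k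
    by (intro integrable_mult_right integrable_ball_moment R)
  have val: "(\<integral>x. ?f k x \<partial>lborel) = ?V * ?t ?s k" for k
    unfolding integral_mult_right_zero integral_ball_moment[OF R] by (simp add: power_mult)
  have abs_f: "norm (?f k x) = 1 / fact (2 * k) * (indicator (cball 0 R) x * (x \<bullet> y) ^ (2 * k))" for k x
    by (simp add: abs_mult power_mult)
  have val_abs: "(\<integral>x. norm (?f k x) \<partial>lborel) = ?V * ?t (- ?s) k" for k
    unfolding abs_f integral_mult_right_zero integral_ball_moment[OF R]
    by (simp add: power_mult power_minus[of ?s])
  have sums: "(\<lambda>k. ?f k x) sums (indicator (cball 0 R) x * cos (x \<bullet> y))" for x
    using sums_mult[OF cos_paired[of "x \<bullet> y"], of "indicator (cball 0 R) x"] by (simp add: mult_ac)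
  have "(\<lambda>k. \<integral>x. ?f k x \<partial>lborel) sums (\<integral>x. (\<Sum>k. ?f k x) \<partial>lborel)"
  proof (rule sums_integral[OF int])
    show "AE x in lborel. summable (\<lambda>k. norm (?f k x))"
    proof (rule AE_I2)
      fix x
      have "summable (\<lambda>k. inverse (fact (2 * k)) * \<bar>x \<bullet> y\<bar> ^ (2 * k))"
      proof (rule summable_comparison_test'[OF summable_exp[of "(x \<bullet> y)\<^sup>2"]])
        fix k :: nat assume "k \<ge> 0"
        have "fact k \<le> (fact (2 * k) :: real)" by (rule fact_mono) simp
        then have "inverse (fact (2 * k)) \<le> (inverse (fact k) :: real)"
          by (intro le_imp_inverse_le) auto
        then show "norm (inverse (fact (2 * k)) * \<bar>x \<bullet> y\<bar> ^ (2 * k)) \<le>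
            inverse (fact k) * ((x \<bullet> y)\<^sup>2) ^ k"
          by (simp add: power_mult mult_right_mono)
      qed
      then have "summable (\<lambda>k. indicator (cball 0 R) x * (inverse (fact (2 * k)) * \<bar>x \<bullet> y\<bar> ^ (2 * k)))"
        by (rule summable_mult)
      then show "summable (\<lambda>k. norm (?f k x))"
        unfolding abs_f by (simp add: power_even_abs divide_inverse mult_ac)
    qed
    show "summable (\<lambda>k. \<integral>x. norm (?f k x) \<partial>lborel)"
      unfolding val_abs by (intro summable_mult summable_bessel_phi) simp
  qed
  then have "(\<lambda>k. ?V * ?t ?s k) sums (\<integral>x. indicator (cball 0 R) x * cos (x \<bullet> y) \<partial>lborel)"
    unfolding val using sums by (simp only: sums_unique[OF sums, symmetric])
  moreover have "(\<lambda>k. ?V * ?t ?s k) sums (?V * bessel_phi ?a ?s)"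
    unfolding bessel_phi_def by (intro sums_mult summable_sums summable_bessel_phi) simp
  ultimately show ?thesis by (rule sums_unique2)
qed

section \<open>Inversion of the cosine transform\<close>

lemma gauss_uminus [simp]: "gauss (- x) = gauss x"
  by (simp add: gauss_eq)

lemma integral_uminus:
  fixes g :: "'a::euclidean_space \<Rightarrow> real"
  assumes "g \<in> borel_measurable borel"
  shows "(\<integral>x. g (- x) \<partial>lborel) = (\<integral>x. g x \<partial>lborel)"
  using integral_scaleR[OF assms, of "-1" 0] by simp

lemma integrable_mult_bounded:
  fixes f h :: "'a::euclidean_space \<Rightarrow> real"
  assumes f: "integrable lborel f" and [measurable]: "h \<in> borel_measurable borel" and bd: "\<And>x. \<bar>h x\<bar> \<le> K"
  shows "integrable lborel (\<lambda>x. f x * h x)"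
  using integrable_mult_left[OF f, of K]
proof (rule Bochner_Integration.integrable_bound)
  have [measurable]: "f \<in> borel_measurable borel" using f by auto
  show "(\<lambda>x. f x * h x) \<in> borel_measurable lborel" by measurable
  show "AE x in lborel. norm (f x * h x) \<le> norm (f x * K)"
  proof (rule AE_I2)
    fix x
    have "\<bar>h x\<bar> \<le> \<bar>K\<bar>" using bd[of x] by linarith
    then show "norm (f x * h x) \<le> norm (f x * K)"
      unfolding real_norm_def abs_mult by (intro mult_left_mono) auto
  qed
qed

lemma gauss_le_exp:
  fixes x :: "'a::euclidean_space"
  shows "gauss x \<le> exp (- (norm x)\<^sup>2 / 2)"
proof -
  have "1 \<le> sqrt (2 * pi) ^ DIM('a)" using pi_ge_two by (intro one_le_power) simp
  then have "exp (- (norm x)\<^sup>2 / 2) / sqrt (2 * pi) ^ DIM('a) \<le> exp (- (norm x)\<^sup>2 / 2) / 1"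
    by (intro divide_left_mono) auto
  then show ?thesis by (simp add: gauss_eq)
qed

lemma gauss_le_1: "gauss x \<le> 1"
  using gauss_le_exp[of x] by (rule order.trans) simp

lemma integrable_mult_gauss_kernel:
  fixes f :: "'a::euclidean_space \<Rightarrow> real"
  assumes f: "integrable lborel f" and c: "c \<ge> 0"
  shows "integrable lborel (\<lambda>z. f z * (c * gauss (r *\<^sub>R (z + u))))"
proof (rule integrable_mult_bounded[OF f])
  fix z
  have "c * gauss (r *\<^sub>R (z + u)) \<le> c * 1" by (intro mult_left_mono gauss_le_1 c)
  then show "\<bar>c * gauss (r *\<^sub>R (z + u))\<bar> \<le> c * 1" using c by simp
qed measurable

text \<open>The transform of the weight \<open>exp (- norm y ^ 2 / (2 * t ^ 2))\<close> is the Gaussian approximate identity of width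
  \<open>1 / (2 * pi * t)\<close>, already normalised to total mass \<open>1\<close>.\<close>

lemma integral_gauss_weight_cos:
  fixes w :: "'a::euclidean_space"
  assumes t: "t > 0"
  shows "(\<integral>y. exp (- (norm y)\<^sup>2 / (2 * t\<^sup>2)) * cos (2 * pi * (w \<bullet> y)) \<partial>lborel) =
    (2 * pi * t) ^ DIM('a) * gauss ((2 * pi * t) *\<^sub>R w)"
proof -
  let ?C = "sqrt (2 * pi) ^ DIM('a)"
  have C: "?C * ?C = (2 * pi) ^ DIM('a)"
    by (subst power_mult_distrib[symmetric]) simp
  have g: "exp (- (norm v)\<^sup>2 / 2) = ?C * gauss v" for v :: 'a
    by (simp add: gauss_eq)
  have "(\<integral>y. exp (- (norm y)\<^sup>2 / (2 * t\<^sup>2)) * cos (2 * pi * (w \<bullet> y)) \<partial>lborel) =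
      t ^ DIM('a) * (\<integral>v. exp (- (norm v)\<^sup>2 / 2) * cos (2 * pi * t * (w \<bullet> v)) \<partial>lborel)"
    using t by (subst integral_scaleR[of _ t 0]) (simp_all add: power_mult_distrib mult.left_commute[of t] mult.assoc)
  also have "(\<integral>v. exp (- (norm v)\<^sup>2 / 2) * cos (2 * pi * t * (w \<bullet> v)) \<partial>lborel) =
      ?C * (\<integral>v. gauss v * cos (v \<bullet> ((2 * pi * t) *\<^sub>R w)) \<partial>lborel)"
    unfolding g by (simp add: mult.assoc inner_commute)
  also have "\<dots> = ?C * (?C * gauss ((2 * pi * t) *\<^sub>R w))"
    unfolding integral_gauss_cos g ..
  also have "t ^ DIM('a) * \<dots> = (2 * pi * t) ^ DIM('a) * gauss ((2 * pi * t) *\<^sub>R w)"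
    unfolding mult.assoc[symmetric, of ?C] C by (simp add: power_mult_distrib mult_ac)
  finally show ?thesis .
qed

lemma integrable_gauss_weight:
  assumes t: "t > 0"
  shows "integrable lborel (\<lambda>y :: 'a::euclidean_space. exp (- (norm y)\<^sup>2 / (2 * t\<^sup>2)))"
proof -
  have "integrable lborel (\<lambda>y :: 'a. sqrt (2 * pi) ^ DIM('a) * gauss (0 + (1 / t) *\<^sub>R y))"
    using t by (intro integrable_mult_right integrable_scaleR integrable_gauss) auto
  also have "(\<lambda>y :: 'a. sqrt (2 * pi) ^ DIM('a) * gauss (0 + (1 / t) *\<^sub>R y)) =
      (\<lambda>y. exp (- (norm y)\<^sup>2 / (2 * t\<^sup>2)))"
    by (simp add: gauss_eq power_divide mult.commute)
  finally show ?thesis .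
qed

text \<open>With the Gaussian weight the double integral converges absolutely and Fubini applies.  The product of
  the two cosines is the mean of the cosines at \<open>z - x\<close> and \<open>z + x\<close>, and evenness of \<open>f\<close> identifies the two
  contributions.\<close>

lemma gauss_convolution_eq:
  fixes f :: "'a::euclidean_space \<Rightarrow> real"
  assumes f: "integrable lborel f" and even: "\<And>x. f (- x) = f x" and t: "t > 0"
    and F: "\<And>y. F y = (\<integral>x. f x * cos (2 * pi * (x \<bullet> y)) \<partial>lborel)"
  shows "(\<integral>y. F y * cos (2 * pi * (x \<bullet> y)) * exp (- (norm y)\<^sup>2 / (2 * t\<^sup>2)) \<partial>lborel) =
    (\<integral>z. f z * ((2 * pi * t) ^ DIM('a) * gauss ((2 * pi * t) *\<^sub>R (z - x))) \<partial>lborel)"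
proof -
  let ?e = "\<lambda>y :: 'a. exp (- (norm y)\<^sup>2 / (2 * t\<^sup>2))"
  let ?k = "\<lambda>w :: 'a. (2 * pi * t) ^ DIM('a) * gauss ((2 * pi * t) *\<^sub>R w)"
  have [measurable]: "f \<in> borel_measurable borel" using f by auto
  have "(\<integral>y. F y * cos (2 * pi * (x \<bullet> y)) * ?e y \<partial>lborel) =
      (\<integral>y. (\<integral>z. f z * ?e y * (cos (2 * pi * (z \<bullet> y)) * cos (2 * pi * (x \<bullet> y))) \<partial>lborel) \<partial>lborel)"
  proof (rule Bochner_Integration.integral_cong[OF refl])
    fix y
    have "(\<integral>z. f z * ?e y * (cos (2 * pi * (z \<bullet> y)) * cos (2 * pi * (x \<bullet> y))) \<partial>lborel) =
        (\<integral>z. (f z * cos (2 * pi * (z \<bullet> y))) * (cos (2 * pi * (x \<bullet> y)) * ?e y) \<partial>lborel)"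
      by (simp only: mult_ac)
    also have "\<dots> = F y * (cos (2 * pi * (x \<bullet> y)) * ?e y)"
      unfolding F by (rule integral_mult_left_zero)
    finally show "F y * cos (2 * pi * (x \<bullet> y)) * ?e y =
        (\<integral>z. f z * ?e y * (cos (2 * pi * (z \<bullet> y)) * cos (2 * pi * (x \<bullet> y))) \<partial>lborel)"
      by simp
  qed
  also have "\<dots> = (\<integral>z. (\<integral>y. f z * ?e y * (cos (2 * pi * (z \<bullet> y)) * cos (2 * pi * (x \<bullet> y))) \<partial>lborel) \<partial>lborel)"
  proof (rule integral_bounded_kernel_swap[OF f integrable_gauss_weight[OF t]])
    show "\<bar>cos (2 * pi * (z \<bullet> y)) * cos (2 * pi * (x \<bullet> y))\<bar> \<le> 1" for z y :: 'a
      unfolding abs_mult by (intro mult_le_one abs_cos_le_one) auto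
  qed measurable
  also have "\<dots> = (\<integral>z. f z * ((?k (z - x) + ?k (z + x)) / 2) \<partial>lborel)"
  proof (rule Bochner_Integration.integral_cong[OF refl])
    fix z
    have "(\<integral>y. f z * ?e y * (cos (2 * pi * (z \<bullet> y)) * cos (2 * pi * (x \<bullet> y))) \<partial>lborel) =
        (\<integral>y. f z / 2 * (?e y * cos (2 * pi * ((z - x) \<bullet> y)) + ?e y * cos (2 * pi * ((z + x) \<bullet> y))) \<partial>lborel)"
    proof (rule Bochner_Integration.integral_cong[OF refl])
      fix y
      have c: "cos (2 * pi * (z \<bullet> y)) * cos (2 * pi * (x \<bullet> y)) =
          (cos (2 * pi * ((z - x) \<bullet> y)) + cos (2 * pi * ((z + x) \<bullet> y))) / 2"
        by (simp add: cos_times_cos inner_diff_left inner_add_left right_diff_distrib distrib_left)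
      show "f z * ?e y * (cos (2 * pi * (z \<bullet> y)) * cos (2 * pi * (x \<bullet> y))) =
          f z / 2 * (?e y * cos (2 * pi * ((z - x) \<bullet> y)) + ?e y * cos (2 * pi * ((z + x) \<bullet> y)))"
        unfolding c by (simp add: distrib_left add_divide_distrib)
    qed
    also have "\<dots> = f z / 2 * (?k (z - x) + ?k (z + x))"
    proof -
      have int: "integrable lborel (\<lambda>y. ?e y * cos (2 * pi * (w \<bullet> y)))" for w
        by (rule integrable_mult_bounded[OF integrable_gauss_weight[OF t], where K = 1]) auto
      show ?thesis
        unfolding integral_mult_right_zero Bochner_Integration.integral_add[OF int int]
          integral_gauss_weight_cos[OF t] ..
    qed
    finally show "(\<integral>y. f z * ?e y * (cos (2 * pi * (z \<bullet> y)) * cos (2 * pi * (x \<bullet> y))) \<partial>lborel) =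
        f z * ((?k (z - x) + ?k (z + x)) / 2)" by simp
  qed
  also have "\<dots> = ((\<integral>z. f z * ?k (z - x) \<partial>lborel) + (\<integral>z. f z * ?k (z + x) \<partial>lborel)) / 2"
  proof -
    have int: "integrable lborel (\<lambda>z. f z * ?k (z + u))" for u
      using t by (intro integrable_mult_gauss_kernel f) simp
    have "(\<integral>z. f z * ((?k (z - x) + ?k (z + x)) / 2) \<partial>lborel) =
        (\<integral>z. (f z * ?k (z + (- x)) + f z * ?k (z + x)) / 2 \<partial>lborel)"
      by (simp add: distrib_left)
    also have "\<dots> = ((\<integral>z. f z * ?k (z + (- x)) \<partial>lborel) + (\<integral>z. f z * ?k (z + x) \<partial>lborel)) / 2"
      by (subst integral_divide_zero, subst Bochner_Integration.integral_add[OF int int]) (rule refl)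
    finally show ?thesis by simp
  qed
  also have "(\<integral>z. f z * ?k (z + x) \<partial>lborel) = (\<integral>z. f z * ?k (z - x) \<partial>lborel)"
  proof -
    have k: "?k (- z + x) = ?k (z - x)" for z
      using gauss_uminus[of "(2 * pi * t) *\<^sub>R (z - x)"] by (simp add: scaleR_minus_right[symmetric] del: scaleR_minus_right gauss_uminus)
    have "(\<integral>z. f z * ?k (z + x) \<partial>lborel) = (\<integral>z. f (- z) * ?k (- z + x) \<partial>lborel)"
      by (rule integral_uminus[symmetric]) measurable
    then show ?thesis unfolding k even .
  qed
  finally show ?thesis by simp
qed

text \<open>A continuous integrable function may be unbounded, so \<open>f\<close> is cut at the unit sphere around \<open>x\<close>.  The inner
  part \<open>g\<close> is bounded and dominated convergence applies after rescaling.  On the support of the outer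
  part \<open>h\<close> the kernel is uniformly small.\<close>

lemma gauss_approximate_identity:
  fixes f :: "'a::euclidean_space \<Rightarrow> real"
  assumes f: "integrable lborel f" and cont: "continuous_on UNIV f"
  shows "(\<lambda>n. \<integral>z. f z * (real (Suc n) ^ DIM('a) * gauss (real (Suc n) *\<^sub>R (z - x))) \<partial>lborel) \<longlonglongrightarrow> f x"
proof -
  let ?d = "DIM('a)"
  have [measurable]: "f \<in> borel_measurable borel" using f by auto
  have [measurable]: "cball x 1 \<in> sets borel" by simp
  define g where "g z = indicator (cball x 1) z * f z" for z
  define h where "h z = indicator (- cball x 1) z * f z" for z
  have [measurable]: "g \<in> borel_measurable borel" "h \<in> borel_measurable borel"
    unfolding g_def[abs_def] h_def[abs_def] by measurable
  have fgh: "f z = g z + h z" for z by (auto simp: g_def h_def indicator_def)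
  have int_h: "integrable lborel h"
    using f by (rule Bochner_Integration.integrable_bound) (auto simp: h_def indicator_def)
  let ?k = "\<lambda>n z. real (Suc n) ^ ?d * gauss (real (Suc n) *\<^sub>R (z - x))"
  have k_meas [measurable]: "?k n \<in> borel_measurable borel" for n by measurable
  obtain B where B: "\<And>z. z \<in> cball x 1 \<Longrightarrow> \<bar>f z\<bar> \<le> B"
  proof -
    have "compact (f ` cball x 1)"
      by (intro compact_continuous_image continuous_on_subset[OF cont]) auto
    then obtain B where "\<forall>u\<in>f ` cball x 1. norm u \<le> B"
      using bounded_iff compact_imp_bounded by blast
    then show ?thesis by (intro that[of B]) auto
  qed
  have B0: "0 \<le> B" using B[of x] by simp
  have gB: "\<bar>g z\<bar> \<le> B" for z using B[of z] B0 by (simp add: g_def indicator_def)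
  have subst_g: "(\<integral>z. g z * ?k n z \<partial>lborel) = (\<integral>v. g (x + (1 / real (Suc n)) *\<^sub>R v) * gauss v \<partial>lborel)" for n
    by (subst integral_scaleR[of _ "1 / real (Suc n)" x]) (simp_all add: power_divide mult.left_commute[of "g _"] del: of_nat_Suc)
  have int_gv: "integrable lborel (\<lambda>v. g (x + (1 / real (Suc n)) *\<^sub>R v) * gauss v)" for n
    using integrable_mult_right[OF integrable_gauss, of B]
    by (rule Bochner_Integration.integrable_bound)
      (measurable, rule AE_I2, simp add: abs_mult mult_right_mono gB B0)
  have lim_g: "(\<lambda>n. \<integral>v. g (x + (1 / real (Suc n)) *\<^sub>R v) * gauss v \<partial>lborel) \<longlonglongrightarrow> (\<integral>v. f x * gauss v \<partial>(lborel :: 'a measure))"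
  proof (rule integral_dominated_convergence[where w = "\<lambda>v. B * gauss v"])
    show "AE v in lborel. (\<lambda>n. g (x + (1 / real (Suc n)) *\<^sub>R v) * gauss v) \<longlonglongrightarrow> f x * gauss v"
    proof (intro AE_I2 tendsto_mult tendsto_const)
      fix v :: 'a
      have "(\<lambda>n. x + (1 / real (Suc n)) *\<^sub>R v) \<longlonglongrightarrow> x + 0 *\<^sub>R v"
        using LIMSEQ_inverse_real_of_nat by (intro tendsto_intros) (simp add: inverse_eq_divide)
      then have l: "(\<lambda>n. x + (1 / real (Suc n)) *\<^sub>R v) \<longlonglongrightarrow> x" by simp
      have "isCont f x" using cont by (simp add: continuous_on_eq_continuous_at)
      then have lf: "(\<lambda>n. f (x + (1 / real (Suc n)) *\<^sub>R v)) \<longlonglongrightarrow> f x"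
        using l by (rule isCont_tendsto_compose)
      have "eventually (\<lambda>n. x + (1 / real (Suc n)) *\<^sub>R v \<in> ball x 1) sequentially"
        using l by (rule topological_tendstoD) auto
      then have "eventually (\<lambda>n. f (x + (1 / real (Suc n)) *\<^sub>R v) = g (x + (1 / real (Suc n)) *\<^sub>R v)) sequentially"
        by eventually_elim (simp add: g_def)
      then show "(\<lambda>n. g (x + (1 / real (Suc n)) *\<^sub>R v)) \<longlonglongrightarrow> f x"
        by (rule Lim_transform_eventually[OF lf])
    qed
    show "AE v in lborel. norm (g (x + (1 / real (Suc n)) *\<^sub>R v) * gauss v) \<le> B * gauss v" for n
      by (rule AE_I2) (simp add: abs_mult mult_right_mono gB)
    show "integrable lborel (\<lambda>v :: 'a. B * gauss v)" by (intro integrable_mult_right integrable_gauss)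
  qed measurable
  define c where "c n = real (Suc n) ^ ?d * exp (- (real (Suc n) / 2))" for n
  have c_lim: "c \<longlonglongrightarrow> 0"
  proof -
    have "((\<lambda>x :: real. 2 ^ ?d * (x ^ ?d / exp x)) \<longlongrightarrow> 2 ^ ?d * 0) at_top"
      by (intro tendsto_mult tendsto_const tendsto_power_div_exp_0)
    moreover have "filterlim (\<lambda>n. real (Suc n) / 2) at_top sequentially"
    proof -
      have "filterlim (\<lambda>n. real (Suc n)) at_top sequentially"
        by (rule filterlim_compose[OF filterlim_real_sequentially filterlim_Suc])
      then have "filterlim (\<lambda>n. 1 / 2 * real (Suc n)) at_top sequentially"
        by (intro filterlim_tendsto_pos_mult_at_top[OF tendsto_const]) auto
      then show ?thesis by (simp del: of_nat_Suc)
    qed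
    ultimately have "(\<lambda>n. 2 ^ ?d * ((real (Suc n) / 2) ^ ?d / exp (real (Suc n) / 2))) \<longlonglongrightarrow> 2 ^ ?d * 0"
      by (rule filterlim_compose)
    moreover have "2 ^ ?d * ((N / 2) ^ ?d / E) = N ^ ?d * inverse E" for N E :: real
      by (simp add: power_divide inverse_eq_divide)
    ultimately show ?thesis
      unfolding c_def[abs_def] exp_minus by simp
  qed
  have h_le: "\<bar>h z * ?k n z\<bar> \<le> \<bar>h z\<bar> * c n" for n z
  proof (cases "z \<in> cball x 1")
    case True then show ?thesis by (simp add: h_def)
  next
    case False
    let ?N = "real (Suc n)"
    have nz: "1 \<le> norm (z - x)" using False by (simp add: dist_norm norm_minus_commute)
    have "1 * 1 \<le> ?N * (norm (z - x))\<^sup>2"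
      using one_le_power[OF nz, of 2] by (intro mult_mono) auto
    then have "?N * 1 \<le> ?N * (?N * (norm (z - x))\<^sup>2)" by (intro mult_left_mono) auto
    also have "\<dots> = (norm (?N *\<^sub>R (z - x)))\<^sup>2"
      by (simp add: power_mult_distrib power2_eq_square[of ?N] mult.assoc del: of_nat_Suc)
    finally have e: "?N \<le> (norm (?N *\<^sub>R (z - x)))\<^sup>2" by simp
    have "gauss (?N *\<^sub>R (z - x)) \<le> exp (- (norm (?N *\<^sub>R (z - x)))\<^sup>2 / 2)"
      by (rule gauss_le_exp)
    also have "\<dots> \<le> exp (- (?N / 2))"
    proof -
      have "- b / 2 \<le> - (a / 2)" if "a \<le> b" for a b :: real using that by simp
      then show ?thesis unfolding exp_le_cancel_iff using e by blast
    qed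
    finally have "?k n z \<le> c n" unfolding c_def by (intro mult_left_mono) auto
    then show ?thesis by (simp add: abs_mult mult_left_mono)
  qed
  have int_g: "integrable lborel g"
    using f by (rule Bochner_Integration.integrable_bound) (auto simp: g_def indicator_def)
  have int_hk: "integrable lborel (\<lambda>z. h z * ?k n z)" and int_gk: "integrable lborel (\<lambda>z. g z * ?k n z)" for n
    using integrable_mult_gauss_kernel[OF int_h, of "real (Suc n) ^ ?d" "real (Suc n)" "- x"]
      integrable_mult_gauss_kernel[OF int_g, of "real (Suc n) ^ ?d" "real (Suc n)" "- x"]
    by (simp_all del: of_nat_Suc)
  have lim_h: "(\<lambda>n. \<integral>z. h z * ?k n z \<partial>lborel) \<longlonglongrightarrow> 0"
  proof (rule Lim_null_comparison)
    show "eventually (\<lambda>n. norm (\<integral>z. h z * ?k n z \<partial>lborel) \<le> (\<integral>z. \<bar>h z\<bar> \<partial>lborel) * c n) sequentially"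
    proof (rule always_eventually, rule allI)
      fix n
      have "norm (\<integral>z. h z * ?k n z \<partial>lborel) \<le> (\<integral>z. \<bar>h z\<bar> * c n \<partial>lborel)"
        by (rule Bochner_Integration.integral_norm_bound_integral[OF int_hk])
          (use int_h in simp, unfold real_norm_def, rule h_le)
      then show "norm (\<integral>z. h z * ?k n z \<partial>lborel) \<le> (\<integral>z. \<bar>h z\<bar> \<partial>lborel) * c n" by simp
    qed
    show "(\<lambda>n. (\<integral>z. \<bar>h z\<bar> \<partial>lborel) * c n) \<longlonglongrightarrow> 0"
      using tendsto_mult_right_zero[OF c_lim] .
  qed
  have "(\<integral>z. f z * ?k n z \<partial>lborel) =
      (\<integral>v. g (x + (1 / real (Suc n)) *\<^sub>R v) * gauss v \<partial>lborel) + (\<integral>z. h z * ?k n z \<partial>lborel)" for n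
    unfolding fgh distrib_right subst_g[symmetric]
    by (rule Bochner_Integration.integral_add[OF int_gk int_hk])
  then show ?thesis
    using tendsto_add[OF lim_g lim_h] by (simp add: integral_gauss del: of_nat_Suc)
qed

text \<open>Weight the inverse integral by a widening Gaussian: by dominated convergence it tends to the unweighted
  integral, and by the two preceding lemmas it tends to \<open>f x\<close>.\<close>

lemma cos_transform_inversion:
  fixes f :: "'a::euclidean_space \<Rightarrow> real"
  assumes f: "integrable lborel f" and cont: "continuous_on UNIV f" and even: "\<And>x. f (- x) = f x"
    and F: "\<And>y. F y = (\<integral>x. f x * cos (2 * pi * (x \<bullet> y)) \<partial>lborel)" and intF: "integrable lborel F"
  shows "f x = (\<integral>y. F y * cos (2 * pi * (y \<bullet> x)) \<partial>lborel)"
proof -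
  have [measurable]: "F \<in> borel_measurable borel" using intF by auto
  define t where "t n = real (Suc n) / (2 * pi)" for n
  have t: "t n > 0" "2 * pi * t n = real (Suc n)" for n by (simp_all add: t_def)
  let ?I = "\<lambda>n. \<integral>y. F y * cos (2 * pi * (x \<bullet> y)) * exp (- (norm y)\<^sup>2 / (2 * (t n)\<^sup>2)) \<partial>lborel"
  have "?I \<longlonglongrightarrow> f x"
    using gauss_approximate_identity[OF f cont, of x]
    unfolding gauss_convolution_eq[OF f even t(1) F] t(2) .
  moreover have "?I \<longlonglongrightarrow> (\<integral>y. F y * cos (2 * pi * (x \<bullet> y)) \<partial>lborel)"
  proof (rule integral_dominated_convergence[where w = "\<lambda>y. \<bar>F y\<bar>"])
    show "AE y in lborel. (\<lambda>n. F y * cos (2 * pi * (x \<bullet> y)) * exp (- (norm y)\<^sup>2 / (2 * (t n)\<^sup>2)))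
        \<longlonglongrightarrow> F y * cos (2 * pi * (x \<bullet> y))"
    proof (rule AE_I2)
      fix y :: 'a
      have "(\<lambda>n. exp (- ((norm y)\<^sup>2 * (2 * pi)\<^sup>2 / 2) * (1 / real (Suc n))\<^sup>2)) \<longlonglongrightarrow> exp (- ((norm y)\<^sup>2 * (2 * pi)\<^sup>2 / 2) * 0\<^sup>2)"
        using LIMSEQ_inverse_real_of_nat by (intro tendsto_intros) (simp add: inverse_eq_divide)
      moreover have "- ((norm y)\<^sup>2 * (2 * pi)\<^sup>2 / 2) * (1 / real (Suc n))\<^sup>2 = - (norm y)\<^sup>2 / (2 * (t n)\<^sup>2)" for n
        by (simp add: t_def power_divide)
      ultimately have "(\<lambda>n. exp (- (norm y)\<^sup>2 / (2 * (t n)\<^sup>2))) \<longlonglongrightarrow> 1" by simp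
      from tendsto_mult[OF tendsto_const this]
      show "(\<lambda>n. F y * cos (2 * pi * (x \<bullet> y)) * exp (- (norm y)\<^sup>2 / (2 * (t n)\<^sup>2)))
        \<longlonglongrightarrow> F y * cos (2 * pi * (x \<bullet> y))" by simp
    qed
    show "AE y in lborel. norm (F y * cos (2 * pi * (x \<bullet> y)) * exp (- (norm y)\<^sup>2 / (2 * (t n)\<^sup>2))) \<le> \<bar>F y\<bar>" for n
    proof (rule AE_I2)
      fix y :: 'a
      have "\<bar>cos (2 * pi * (x \<bullet> y))\<bar> * exp (- (norm y)\<^sup>2 / (2 * (t n)\<^sup>2)) \<le> 1"
        by (intro mult_le_one) auto
      then show "norm (F y * cos (2 * pi * (x \<bullet> y)) * exp (- (norm y)\<^sup>2 / (2 * (t n)\<^sup>2))) \<le> \<bar>F y\<bar>"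
        unfolding real_norm_def abs_mult mult.assoc by (intro mult_left_le) auto
    qed
    show "integrable lborel (\<lambda>y. \<bar>F y\<bar>)" using intF by simp
  qed measurable
  ultimately show ?thesis by (simp add: LIMSEQ_unique inner_commute)
qed

section \<open>Mass of the negative part\<close>

lemma bessel_phi_ge_neg_lam:
  assumes "d \<ge> 2" "s \<ge> 0"
  shows "- lam d \<le> bessel_phi (real d / 2 + 1) s"
proof (cases "s = 0")
  case True
  then show ?thesis using lam_nonneg[OF assms(1)] by simp
next
  case False
  then show ?thesis using lam_ge_neg_bessel_phi[of s d] assms(2) by simp
qed

lemma integral_positive_part_le_negative_part:
  fixes f :: "'a \<Rightarrow> real"
  assumes f: "integrable M f" and "(\<integral>x. f x \<partial>M) \<le> 0"
  shows "(\<integral>x. max (f x) 0 \<partial>M) \<le> (\<integral>x. max (- f x) 0 \<partial>M)"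
proof -
  have "(\<integral>x. f x \<partial>M) = (\<integral>x. max (f x) 0 - max (- f x) 0 \<partial>M)"
    by (intro Bochner_Integration.integral_cong refl) auto
  also have "\<dots> = (\<integral>x. max (f x) 0 \<partial>M) - (\<integral>x. max (- f x) 0 \<partial>M)"
    using f by (intro Bochner_Integration.integral_diff) auto
  finally show ?thesis using assms(2) by linarith
qed

lemma AE_eq_0_if_negative_part_vanishes:
  fixes f :: "'a \<Rightarrow> real"
  assumes f: "integrable M f" and le: "(\<integral>x. f x \<partial>M) \<le> 0" and neg: "(\<integral>x. max (- f x) 0 \<partial>M) \<le> 0"
  shows "AE x in M. f x = 0"
proof -
  have int: "integrable M (\<lambda>x. max (f x) 0)" "integrable M (\<lambda>x. max (- f x) 0)"
    using f by auto
  have nonneg: "0 \<le> (\<integral>x. max (f x) 0 \<partial>M)" "0 \<le> (\<integral>x. max (- f x) 0 \<partial>M)" by simp_all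
  then have "(\<integral>x. max (f x) 0 \<partial>M) = 0" "(\<integral>x. max (- f x) 0 \<partial>M) = 0"
    using integral_positive_part_le_negative_part[OF f le] neg by linarith+
  then have "AE x in M. max (f x) 0 = 0" "AE x in M. max (- f x) 0 = 0"
    using int by (simp_all add: integral_nonneg_eq_0_iff_AE)
  then show ?thesis by eventually_elim (auto simp: max_def split: if_splits)
qed

text \<open>The heart of the matter.  Let \<open>S\<close> be the set where \<open>g\<close> is negative; it lies in the ball \<open>B\<close> of radius \<open>b\<close>.  The
  negative mass of \<open>g\<close> is minus its integral over \<open>S\<close>, that is, the integral of \<open>- f x * c x\<close> where \<open>c\<close> is the cosine transform of the indicator
  of \<open>S\<close>.  Estimating \<open>c\<close> from below by \<open>- K\<close> where \<open>f\<close> is positive and from above by the volume \<open>s\<close> of \<open>S\<close> where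
  \<open>f\<close> is negative gives at most \<open>s + K\<close> times the negative mass of \<open>f\<close>.  The choice of \<open>K\<close> rests on the fact that
  \<open>1 - cos\<close> is nonnegative: its integral over \<open>S\<close> is at most its integral over \<open>B\<close>, for which the transform of the
  ball gives the bound \<open>V * (1 + lam d)\<close>.  Hence \<open>s\<close> and \<open>K\<close> trade off with the constant sum \<open>V * (1 + lam d)\<close>,
  whatever the shape of \<open>S\<close>.\<close>

lemma negative_mass_bound:
  fixes f g :: "'a::euclidean_space \<Rightarrow> real"
  defines "d \<equiv> DIM('a)"
  assumes d: "d \<ge> 2" and f: "integrable lborel f" and g: "integrable lborel g"
    and trans: "\<And>y. g y = (\<integral>x. f x * cos (2 * pi * (x \<bullet> y)) \<partial>lborel)"
    and le: "(\<integral>x. f x \<partial>lborel) \<le> 0"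
    and b: "b > 0" and out: "\<And>y. norm y > b \<Longrightarrow> g y \<ge> 0"
  shows "(\<integral>y. max (- g y) 0 \<partial>lborel) \<le>
    unit_ball_vol d * b ^ d * (1 + lam d) * (\<integral>x. max (- f x) 0 \<partial>lborel)"
proof -
  have [measurable]: "f \<in> borel_measurable borel" "g \<in> borel_measurable borel" using f g by auto
  define V where "V = unit_ball_vol d * b ^ d"
  define S where "S = {y. g y < 0}"
  have [measurable]: "S \<in> sets borel" unfolding S_def by measurable
  have S_sub: "S \<subseteq> cball 0 b" 
  proof
    fix y assume "y \<in> S"
    then have "\<not> norm y > b" using out[of y] by (auto simp: S_def)
    then show "y \<in> cball 0 b" by simp
  qed
  then have S_norm: "norm y \<le> b" if "y \<in> S" for y using that by auto
  have ball_cos: "(\<integral>y. indicator (cball 0 b) y * cos (2 * pi * (x \<bullet> y)) \<partial>lborel) =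
      V * bessel_phi (real d / 2 + 1) ((b * norm ((2 * pi) *\<^sub>R x) / 2)\<^sup>2)" for x :: 'a
    using integral_ball_cos[OF b, of "(2 * pi) *\<^sub>R x"]
    by (simp add: V_def d_def inner_commute)
  have int_B: "integrable lborel (indicator (cball (0::'a) b) :: 'a \<Rightarrow> real)"
    by (rule integrable_real_indicator) (simp, rule emeasure_bounded_finite, simp)
  have int_S: "integrable lborel (indicator S :: 'a \<Rightarrow> real)"
    using int_B by (rule Bochner_Integration.integrable_bound)
      (measurable, rule AE_I2, simp add: indicator_def S_norm)
  have vol_B: "(\<integral>y. indicator (cball (0::'a) b) y \<partial>lborel) = V"
    using ball_cos[of 0] by simp
  define s :: real where "s = (\<integral>y. indicator S y \<partial>(lborel :: 'a measure))"
  define c where "c x = (\<integral>y. indicator S y * cos (2 * pi * (x \<bullet> y)) \<partial>lborel)" for x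
  have int_cos: "integrable lborel (\<lambda>y. indicator A y * cos (2 * pi * (x \<bullet> y)))"
    if "integrable lborel (indicator A :: 'a \<Rightarrow> real)" for A x
    using that by (rule integrable_mult_bounded[where K = 1]) auto
  define K where "K = V * (1 + lam d) - s"
  have V: "V \<ge> 0" using b by (simp add: V_def)
  have "s \<le> (\<integral>y. indicator (cball (0::'a) b) y \<partial>lborel)"
    unfolding s_def by (intro integral_mono int_S int_B) (auto simp: indicator_def S_norm)
  then have s_le: "s \<le> V" unfolding vol_B .
  have s0: "0 \<le> s" unfolding s_def by simp
  have "V \<le> V * (1 + lam d)" using V lam_nonneg[OF d] by (simp add: distrib_left)
  then have K0: "K \<ge> 0" unfolding K_def using s_le by linarith
  have c_le: "c x \<le> s" for x
    unfolding c_def s_def by (intro integral_mono int_cos int_S) (auto simp: indicator_def)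
  have c_ge_s: "- s \<le> c x" for x
  proof -
    have "- s = (\<integral>y. - indicator S y \<partial>lborel)" by (simp add: s_def)
    also have "\<dots> \<le> c x"
      unfolding c_def by (intro integral_mono int_cos integrable_minus int_S) (auto simp: indicator_def minus_le_iff)
    finally show ?thesis .
  qed
  \<comment> \<open>enlarging \<open>S\<close> to the ball only increases the integral of \<open>1 - cos\<close>\<close>
  have c_ge: "- K \<le> c x" for x
  proof -
    have "s - c x = (\<integral>y. indicator S y - indicator S y * cos (2 * pi * (x \<bullet> y)) \<partial>lborel)"
      unfolding s_def c_def by (rule Bochner_Integration.integral_diff[symmetric, OF int_S int_cos[OF int_S]])
    also have "\<dots> \<le> (\<integral>y. indicator (cball 0 b) y - indicator (cball 0 b) y * cos (2 * pi * (x \<bullet> y)) \<partial>lborel)"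
      by (intro integral_mono Bochner_Integration.integrable_diff int_cos int_S int_B)
        (auto simp: indicator_def S_norm)
    also have "\<dots> = V - V * bessel_phi (real d / 2 + 1) ((b * norm ((2 * pi) *\<^sub>R x) / 2)\<^sup>2)"
      unfolding Bochner_Integration.integral_diff[OF int_B int_cos[OF int_B]] vol_B ball_cos ..
    also have "\<dots> \<le> V * (1 + lam d)"
      using mult_left_mono[OF bessel_phi_ge_neg_lam[OF d] V, of "(b * norm ((2 * pi) *\<^sub>R x) / 2)\<^sup>2"]
      by (simp add: distrib_left)
    finally show ?thesis unfolding K_def by linarith
  qed
  have [measurable]: "c \<in> borel_measurable borel" unfolding c_def[abs_def] by measurable
  have int_fc: "integrable lborel (\<lambda>x. f x * c x)"
    using integrable_mult_left[OF f, of s]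
  proof (rule Bochner_Integration.integrable_bound)
    show "AE x in lborel. norm (f x * c x) \<le> norm (f x * s)"
    proof (rule AE_I2)
      fix x
      have "\<bar>c x\<bar> \<le> \<bar>s\<bar>" using c_le[of x] c_ge_s[of x] by linarith
      then show "norm (f x * c x) \<le> norm (f x * s)"
        unfolding real_norm_def abs_mult by (intro mult_left_mono) auto
    qed
  qed measurable
  have "(\<integral>y. max (- g y) 0 \<partial>lborel) = (\<integral>y. - (\<integral>x. f x * indicator S y * cos (2 * pi * (x \<bullet> y)) \<partial>lborel) \<partial>lborel)"
  proof (rule Bochner_Integration.integral_cong[OF refl])
    fix y
    have "(\<integral>x. f x * indicator S y * cos (2 * pi * (x \<bullet> y)) \<partial>lborel) =
        (\<integral>x. indicator S y * (f x * cos (2 * pi * (x \<bullet> y))) \<partial>lborel)"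
      by (simp only: mult_ac)
    also have "\<dots> = indicator S y * g y"
      unfolding trans by (rule integral_mult_right_zero)
    finally show "max (- g y) 0 = - (\<integral>x. f x * indicator S y * cos (2 * pi * (x \<bullet> y)) \<partial>lborel)"
      by (auto simp: S_def indicator_def)
  qed
  also have "\<dots> = - (\<integral>y. (\<integral>x. f x * indicator S y * cos (2 * pi * (x \<bullet> y)) \<partial>lborel) \<partial>lborel)"
    by simp
  also have "\<dots> = - (\<integral>x. (\<integral>y. f x * indicator S y * cos (2 * pi * (x \<bullet> y)) \<partial>lborel) \<partial>lborel)"
    by (subst integral_bounded_kernel_swap[OF f int_S]) auto
  also have "\<dots> = (\<integral>x. - (f x * c x) \<partial>lborel)"
    by (simp add: c_def mult.assoc)
  also have "\<dots> \<le> (\<integral>x. s * max (- f x) 0 + K * max (f x) 0 \<partial>lborel)"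
  proof (rule integral_mono)
    show "integrable lborel (\<lambda>x. - (f x * c x))" using int_fc by simp
    show "integrable lborel (\<lambda>x. s * max (- f x) 0 + K * max (f x) 0)" using f by simp
    fix x
    show "- (f x * c x) \<le> s * max (- f x) 0 + K * max (f x) 0"
    proof (cases "f x \<ge> 0")
      case True
      then have "f x * (- K) \<le> f x * c x" using c_ge[of x] by (intro mult_left_mono)
      then show ?thesis using True by (simp add: mult.commute)
    next
      case False
      then have "- f x * c x \<le> - f x * s" using c_le[of x] by (intro mult_left_mono) auto
      then show ?thesis using False by (simp add: mult.commute)
    qed
  qed
  also have "\<dots> = s * (\<integral>x. max (- f x) 0 \<partial>lborel) + K * (\<integral>x. max (f x) 0 \<partial>lborel)"
    using f by (subst Bochner_Integration.integral_add) auto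
  also have "\<dots> \<le> s * (\<integral>x. max (- f x) 0 \<partial>lborel) + K * (\<integral>x. max (- f x) 0 \<partial>lborel)"
    by (intro add_left_mono mult_left_mono integral_positive_part_le_negative_part f le K0)
  also have "\<dots> = V * (1 + lam d) * (\<integral>x. max (- f x) 0 \<partial>lborel)"
    by (simp add: K_def algebra_simps)
  finally show ?thesis unfolding V_def .
qed

section \<open>Sign radii\<close>

text \<open>The factors \<open>pi powr (d / 2)\<close> in the two ball volumes become the factor \<open>1 / pi\<close> after
  taking \<open>d\<close>-th roots.\<close>

lemma radius_product_bound:
  fixes d :: nat
  assumes d: "d > 0" and r: "r1 > 0" "r2 > 0" and L: "L > 0"
    and le: "1 \<le> (unit_ball_vol d * r1 ^ d * L) * (unit_ball_vol d * r2 ^ d * L)"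
  shows "1 / pi * (1 / L * Gamma (real d / 2 + 1)) powr (2 / real d) \<le> r1 * r2"
proof -
  define v where "v = unit_ball_vol d"
  have v: "v > 0" by (simp add: v_def)
  have G: "Gamma (real d / 2 + 1) > 0" by (intro Gamma_real_pos add_nonneg_pos) auto
  have "1 \<le> (v * L)\<^sup>2 * (r1 * r2) ^ d"
    using le by (simp add: v_def power2_eq_square power_mult_distrib mult_ac)
  then have "(1 / (v * L))\<^sup>2 \<le> (r1 * r2) ^ d"
    using v L by (simp add: power_divide divide_le_eq mult.commute)
  then have "((1 / (v * L))\<^sup>2) powr (1 / d) \<le> ((r1 * r2) ^ d) powr (1 / d)"
    by (intro powr_mono2) auto
  also have "((r1 * r2) ^ d) powr (1 / d) = r1 * r2"
    using r d by (simp add: powr_realpow[symmetric] powr_powr)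
  also have "((1 / (v * L))\<^sup>2) powr (1 / d) = (1 / (v * L)) powr (2 / d)"
  proof -
    have "(w\<^sup>2) powr (1 / d) = w powr (2 / d)" if "w > 0" for w :: real
    proof -
      have "(w\<^sup>2) powr (1 / d) = (w powr 2) powr (1 / d)" using that by (simp only: powr_numeral)
      also have "\<dots> = w powr (2 / d)" by (simp add: powr_powr)
      finally show ?thesis .
    qed
    then show ?thesis using v L by simp
  qed
  also have "1 / (v * L) = pi powr (- real d / 2) * (1 / L * Gamma (real d / 2 + 1))"
    using G L by (simp add: v_def unit_ball_vol_def powr_minus divide_simps)
  also have "\<dots> powr (2 / d) = 1 / pi * (1 / L * Gamma (real d / 2 + 1)) powr (2 / real d)"
  proof -
    have "(pi powr (- real d / 2)) powr (2 / d) = pi powr (- 1)"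
      unfolding powr_powr using d by simp
    also have "\<dots> = 1 / pi" by (simp add: powr_minus_divide)
    finally show ?thesis using G L by (subst powr_mult) simp_all
  qed
  finally show ?thesis .
qed

lemma fourier_eq_cos_transform:
  fixes f :: "real ^ 'n \<Rightarrow> real"
  assumes f: "integrable lborel f"
  shows "Re (fourier f y) = (\<integral>x. f x * cos (2 * pi * (x \<bullet> y)) \<partial>lborel)"
proof -
  have [measurable]: "f \<in> borel_measurable borel" using f by auto
  let ?g = "\<lambda>x. complex_of_real (f x) * exp (- 2 * complex_of_real pi * \<i> * complex_of_real (x \<bullet> y))"
  have "integrable lborel ?g"
    using f by (rule Bochner_Integration.integrable_bound) (auto simp: norm_mult)
  then have "Re (fourier f y) = (\<integral>x. Re (?g x) \<partial>lborel)"
    unfolding fourier_def by (rule integral_Re[symmetric])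
  also have "\<dots> = (\<integral>x. f x * cos (2 * pi * (x \<bullet> y)) \<partial>lborel)"
    by (simp add: Re_exp mult.assoc)
  finally show ?thesis .
qed

text \<open>If the radius were \<open>0\<close>, the function would be nonnegative off the origin.  Positivity rules out the
  product \<open>0 * \<infinity> = 0\<close> in the extended reals when the other function has no admissible radius.\<close>

lemma sign_radius_pos:
  fixes g :: "real ^ 'n \<Rightarrow> real"
  assumes "0 < (\<integral>x. max (- g x) 0 \<partial>lborel)"
  shows "0 < sign_radius g"
proof (rule ccontr)
  assume not_pos: "\<not> 0 < sign_radius g"
  have "g x \<ge> 0" if "x \<noteq> 0" for x
  proof -
    have "sign_radius g < ereal (norm x)"
      using not_pos that by (simp add: not_less) (meson ereal_less(2) le_less_trans zero_less_norm_iff)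
    then obtain r where "ereal r < ereal (norm x)" "\<forall>x. norm x > r \<longrightarrow> g x \<ge> 0"
      unfolding sign_radius_def Inf_less_iff by blast
    then show ?thesis by simp
  qed
  then have z: "max (- g x) 0 = 0" if "x \<noteq> 0" for x using that by (simp add: max_def)
  have "AE x in lborel. x \<noteq> (0 :: real ^ 'n)" by (rule AE_lborel_singleton)
  then have "AE x in lborel. max (- g x) 0 = 0" by eventually_elim (rule z)
  then have "(\<integral>x. max (- g x) 0 \<partial>lborel) = 0" by (rule integral_eq_zero_AE)
  then show False using assms by simp
qed

lemma sign_radius_mult_ge:
  fixes f g :: "real ^ 'n \<Rightarrow> real"
  assumes pos: "0 < sign_radius f" "0 < sign_radius g"
    and le: "\<And>r1 r2. r1 > 0 \<Longrightarrow> r2 > 0 \<Longrightarrow> (\<And>x. norm x > r1 \<Longrightarrow> f x \<ge> 0) \<Longrightarrow>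
      (\<And>x. norm x > r2 \<Longrightarrow> g x \<ge> 0) \<Longrightarrow> c \<le> r1 * r2"
  shows "ereal c \<le> sign_radius f * sign_radius g"
proof -
  let ?R = "\<lambda>h :: real ^ 'n \<Rightarrow> real. {r. r > 0 \<and> (\<forall>x. norm x > r \<longrightarrow> h x \<ge> 0)}"
  have R: "sign_radius h = Inf (ereal ` ?R h)" for h
    unfolding sign_radius_def by (rule arg_cong[where f = Inf]) auto
  show ?thesis
  proof (cases "?R f = {} \<or> ?R g = {}")
    case True
    have "sign_radius h = \<infinity>" if "?R h = {}" for h
      unfolding R that by (simp add: top_ereal_def)
    with True have "sign_radius f = \<infinity> \<or> sign_radius g = \<infinity>" by blast
    then have "sign_radius f * sign_radius g = \<infinity>"
      using pos by (auto simp: ereal_mult_eq_PInfty)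
    then show ?thesis by (simp only: ereal_less_eq(1))
  next
    case False
    then obtain p q where p: "p \<in> ?R f" and q: "q \<in> ?R g" by blast
    have "sign_radius f \<le> ereal p" "sign_radius g \<le> ereal q"
      unfolding R using p q by (auto intro!: INF_lower)
    then obtain A B where AB: "sign_radius f = ereal A" "sign_radius g = ereal B" "A > 0" "B > 0"
      using pos by (cases "sign_radius f"; cases "sign_radius g") auto
    have le_A: "c / r2 \<le> A" if r2: "r2 \<in> ?R g" for r2
    proof -
      have "ereal (c / r2) \<le> sign_radius f"
        unfolding R
      proof (rule INF_greatest)
        fix r1 assume "r1 \<in> ?R f"
        then have "c \<le> r1 * r2" using le[of r1 r2] r2 by simp
        then show "ereal (c / r2) \<le> ereal r1" using r2 by (simp add: divide_le_eq)
      qed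
      then show ?thesis unfolding AB by simp
    qed
    have "c / A \<le> r2" if r2: "r2 \<in> ?R g" for r2
      using le_A[OF r2] r2 AB by (simp add: divide_le_eq mult.commute)
    then have "ereal (c / A) \<le> sign_radius g"
      unfolding R by (intro INF_greatest) auto
    then have "c \<le> A * B" unfolding AB using AB by (simp add: divide_le_eq mult.commute)
    then show ?thesis unfolding AB by simp
  qed
qed

text \<open>The negative mass bound is applied to \<open>f\<close> and \<open>F\<close> in both directions, which inversion makes symmetric: \<open>f 0\<close> and \<open>F 0\<close>
  are the integrals of \<open>F\<close> and \<open>f\<close>.  Multiplying the two inequalities
  cancels the negative masses, which are positive because neither function vanishes almost everywhere.\<close>

lemma sign_uncertainty:
  fixes f :: "real ^ 'n \<Rightarrow> real"
  assumes d: "CARD('n) \<ge> 2" and f: "integrable lborel f" and cont: "continuous_on UNIV f"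
    and nz: "f \<noteq> (\<lambda>x. 0)" and rad: "radial f" and f0: "f 0 \<le> 0"
    and intF: "integrable lborel (fourier f)" and F0: "Re (fourier f 0) \<le> 0"
  shows "ereal (1 / pi * (1 / (1 + lam CARD('n)) * Gamma (real CARD('n) / 2 + 1)) powr (2 / real CARD('n)))
    \<le> sign_radius f * sign_radius (\<lambda>y. Re (fourier f y))"
proof -
  define F where "F y = Re (fourier f y)" for y
  let ?d = "CARD('n)"
  let ?neg = "\<lambda>h :: real ^ 'n \<Rightarrow> real. \<integral>x. max (- h x) 0 \<partial>lborel"
  have F: "F y = (\<integral>x. f x * cos (2 * pi * (x \<bullet> y)) \<partial>lborel)" for y
    unfolding F_def by (rule fourier_eq_cos_transform[OF f])
  have intF: "integrable lborel F"
    unfolding F_def[abs_def] using intF by simp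
  have even: "f (- x) = f x" for x
    using rad unfolding radial_def by (metis norm_minus_cancel)
  have inv: "f x = (\<integral>y. F y * cos (2 * pi * (y \<bullet> x)) \<partial>lborel)" for x
    by (rule cos_transform_inversion[OF f cont even F intF])
  have int_f: "(\<integral>x. f x \<partial>lborel) \<le> 0" using F[of 0] F0 by (simp add: F_def)
  have int_F: "(\<integral>y. F y \<partial>lborel) \<le> 0" using inv[of 0] f0 by simp
  have not_AE_F: "\<not> (AE y in lborel. F y = 0)"
  proof
    assume "AE y in lborel. F y = 0"
    then have "AE y in lborel. F y * cos (2 * pi * (y \<bullet> x)) = 0" for x
      by eventually_elim simp
    then have "f x = 0" for x unfolding inv by (rule integral_eq_zero_AE)
    then show False using nz by auto
  qed
  have not_AE_f: "\<not> (AE x in lborel. f x = 0)"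
  proof
    assume "AE x in lborel. f x = 0"
    then have "AE x in lborel. f x * cos (2 * pi * (x \<bullet> y)) = 0" for y
      by eventually_elim simp
    then have "F y = 0" for y unfolding F by (rule integral_eq_zero_AE)
    then show False using not_AE_F by simp
  qed
  have neg_f: "0 < ?neg f"
    using AE_eq_0_if_negative_part_vanishes[OF f int_f] not_AE_f by (auto simp: not_le[symmetric])
  have neg_F: "0 < ?neg F"
    using AE_eq_0_if_negative_part_vanishes[OF intF int_F] not_AE_F by (auto simp: not_le[symmetric])
  have lam: "1 + lam ?d > 0" using lam_nonneg[OF d] by linarith
  have "ereal (1 / pi * (1 / (1 + lam ?d) * Gamma (real ?d / 2 + 1)) powr (2 / real ?d))
    \<le> sign_radius f * sign_radius F"
  proof (rule sign_radius_mult_ge[OF sign_radius_pos[OF neg_f] sign_radius_pos[OF neg_F]])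
    fix r1 r2 :: real
    assume r: "r1 > 0" "r2 > 0" and out: "\<And>x. norm x > r1 \<Longrightarrow> f x \<ge> 0" "\<And>x. norm x > r2 \<Longrightarrow> F x \<ge> 0"
    let ?a = "unit_ball_vol ?d * r1 ^ ?d * (1 + lam ?d)" and ?b = "unit_ball_vol ?d * r2 ^ ?d * (1 + lam ?d)"
    have 1: "?neg F \<le> ?b * ?neg f"
      using negative_mass_bound[OF _ f intF F int_f r(2) out(2)] d by simp
    have 2: "?neg f \<le> ?a * ?neg F"
      using negative_mass_bound[OF _ intF f inv int_F r(1) out(1)] d by simp
    have "?b \<ge> 0" using r lam by simp
    from order.trans[OF 1 mult_left_mono[OF 2 this]] have "1 * ?neg F \<le> (?a * ?b) * ?neg F"
      by (simp only: mult_1_left mult_ac)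
    then have "1 \<le> ?a * ?b" using neg_F by (rule mult_right_le_imp_le)
    then show "1 / pi * (1 / (1 + lam ?d) * Gamma (real ?d / 2 + 1)) powr (2 / real ?d) \<le> r1 * r2"
      using radius_product_bound[OF _ r lam] by simp
  qed
  then show ?thesis unfolding F_def[abs_def] .
qed

theorem theorem7:
  "(\<forall>f :: real ^ 'n \<Rightarrow> real.
      CARD('n) \<ge> 2 \<longrightarrow>
      integrable lborel f \<longrightarrow> continuous_on UNIV f \<longrightarrow> f \<noteq> (\<lambda>x. 0) \<longrightarrow> radial f \<longrightarrow>
      f 0 \<le> 0 \<longrightarrow>
      integrable lborel (fourier f) \<longrightarrow> Re (fourier f 0) \<le> 0 \<longrightarrow>
      sign_radius f * sign_radius (\<lambda>y. Re (fourier f y))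
        \<ge> ereal (1 / pi * (1 / (1 + lam CARD('n)) * Gamma (real CARD('n) / 2 + 1))
                            powr (2 / real CARD('n))))
   \<and> (\<forall>d\<ge>2. lam d < 1 / 2)
   \<and> (\<exists>C>0. \<exists>q. 0 < q \<and> q < 1 \<and> (\<forall>d\<ge>2. \<bar>lam d\<bar> \<le> C * q ^ d))"
proof (intro conjI allI impI)
  show "\<exists>C>0. \<exists>q. 0 < q \<and> q < 1 \<and> (\<forall>d\<ge>2. \<bar>lam d\<bar> \<le> C * q ^ d)"
  proof (rule exI[of _ "sqrt 2"], intro conjI, simp, rule exI[of _ "exp (- 1 / 8)"], intro conjI allI impI)
    fix d :: nat assume "d \<ge> 2"
    then show "\<bar>lam d\<bar> \<le> sqrt 2 * exp (- 1 / 8) ^ d"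
      using lam_nonneg lam_le_exp by simp
  qed auto
qed (use sign_uncertainty lam_less_half in auto)

end
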